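(* The trace form $\check{\mathcal E}$ is a Dirichlet form in $L^2(X,\mu)$.
   Context: Let $X$ be a locally compact separable metric space, $m$ a positive Radon measure on $X$ with full support $X$, and $\mu$ a positive Radon measure on $X$. Put $\mathcal H:=L^2(X,m)$, $\mathcal H_{\mathrm{aux}}:=L^2(X,\mu)$ (real spaces). Let $\mathcal E$ be a regular Dirichlet form in $L^2(X,m)$ with domain $\mathcal D$, and assume that $\mu$ does not charge any set of zero capacity (capacity with respect to $\mathcal E$). All elements of $\mathcal D$ are taken to be quasi-continuous (every element has a quasi-continuous representative, unique quasi-everywhere and hence $\mu$-a.e.). Let $J\colon\operatorname{dom}J:=\mathcal D\cap L^2(X,\mu)\to L^2(X,\mu)$, $Ju:=u$. Write $\mathcal E_\lambda[u]:=\mathcal E[u]+\lambda\|u\|^2_{L^2(X,m)}$ for $\lambda>0$. The operator $J$ has dense range and is closed from $(\mathcal D,\mathcal E_1^{1/2})$ to $L^2(X,\mu)$. Trace form: for $\lambda>0$ let $P_\lambda$ be the $\mathcal E_\lambda$-orthogonal projection in $(\mathcal D,\mathcal E_\lambda^{1/2})$ onto the $\mathcal E_\lambda$-orthogonal complement of $\ker J$; let $\check{\mathcal E}_\lambda$ be the closed positive densely defined form in $L^2(X,\mu)$ with $\operatorname{dom}\check{\mathcal E}_\lambda:=\operatorname{ran}J$, $\check{\mathcal E}_\lambda[Ju]:=\mathcal E_\lambda[P_\lambda u]$, and $\check H_\lambda$ the associated positive self-adjoint operator. The trace $\check{\mathcal E}$ of $\mathcal E$ with respect to $J$ is the closed form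 associated with the positive self-adjoint operator $\check H$ determined by $(\check H_\lambda+1)^{-1}\to(\check H+1)^{-1}$ strongly as $\lambda\downarrow0$. Equivalently, $\check{\mathcal E}$ is the closure of the regular part (largest closable minorant with the same domain) of the form $\check{\mathcal E}_0[Ju]:=\lim_{\lambda\downarrow0}\check{\mathcal E}_\lambda[Ju]$ on $\operatorname{ran}J$. A Dirichlet form is a densely defined closed positive symmetric form on which the unit contraction $u\mapsto(0\vee u)\wedge1$ operates. *)

theory Defs
  imports "HOL-Analysis.Analysis"
begin

text \<open>
  \<open>L\<^sup>2(X, M)\<close> is represented by its square integrable measurable functions; two functions
  represent the same element iff they agree \<open>M\<close>-almost everywhere.  Form domains are sets of
  representatives that are saturated under almost everywhere equality.
\<close>

definition L2 :: "'a measure \<Rightarrow> ('a \<Rightarrow> real) set" where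
  "L2 M = {f \<in> borel_measurable M. integrable M (\<lambda>x. (f x)\<^sup>2)}"

definition l2_inner :: "'a measure \<Rightarrow> ('a \<Rightarrow> real) \<Rightarrow> ('a \<Rightarrow> real) \<Rightarrow> real" where
  "l2_inner M f g = (\<integral>x. f x * g x \<partial>M)"

definition l2_norm :: "'a measure \<Rightarrow> ('a \<Rightarrow> real) \<Rightarrow> real" where
  "l2_norm M f = sqrt (l2_inner M f f)"


section \<open>Measures\<close>

definition radon_measure :: "'a::topological_space measure \<Rightarrow> bool" where
  "radon_measure M \<longleftrightarrow>
     sets M = sets borel \<and>
     (\<forall>K. compact K \<longrightarrow> emeasure M K < \<infinity>) \<and>
     (\<forall>B\<in>sets borel. emeasure M B = (SUP K\<in>{K. compact K \<and> K \<subseteq> B}. emeasure M K))"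

definition full_support :: "'a::topological_space measure \<Rightarrow> bool" where
  "full_support M \<longleftrightarrow> (\<forall>U. open U \<and> U \<noteq> {} \<longrightarrow> 0 < emeasure M U)"


section \<open>Forms in \<open>L\<^sup>2\<close>\<close>

text \<open>
  The values of \<open>form_val\<close> are only meaningful on the domain \<open>form_dom\<close>; the
  quadratic form \<open>\<E>[u]\<close> is \<open>form_val \<E> u u\<close>.
\<close>

record 'a l2_form =
  form_dom :: "('a \<Rightarrow> real) set"
  form_val :: "('a \<Rightarrow> real) \<Rightarrow> ('a \<Rightarrow> real) \<Rightarrow> real"

definition positive_symmetric_form :: "'a measure \<Rightarrow> 'a l2_form \<Rightarrow> bool" where
  "positive_symmetric_form M \<E> \<longleftrightarrow>
     form_dom \<E> \<subseteq> L2 M \<and>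
     (\<lambda>x. 0) \<in> form_dom \<E> \<and>
     (\<forall>u\<in>form_dom \<E>. \<forall>v\<in>form_dom \<E>. (\<lambda>x. u x + v x) \<in> form_dom \<E>) \<and>
     (\<forall>c. \<forall>u\<in>form_dom \<E>. (\<lambda>x. c * u x) \<in> form_dom \<E>) \<and>
     (\<forall>u\<in>form_dom \<E>. \<forall>v\<in>L2 M. (AE x in M. u x = v x) \<longrightarrow> v \<in> form_dom \<E>) \<and>
     (\<forall>u\<in>form_dom \<E>. \<forall>v\<in>form_dom \<E>. \<forall>w\<in>form_dom \<E>.
        (AE x in M. u x = v x) \<longrightarrow> form_val \<E> u w = form_val \<E> v w) \<and>
     (\<forall>u\<in>form_dom \<E>. \<forall>v\<in>form_dom \<E>. \<forall>w\<in>form_dom \<E>.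
        form_val \<E> (\<lambda>x. u x + v x) w = form_val \<E> u w + form_val \<E> v w) \<and>
     (\<forall>c. \<forall>u\<in>form_dom \<E>. \<forall>w\<in>form_dom \<E>.
        form_val \<E> (\<lambda>x. c * u x) w = c * form_val \<E> u w) \<and>
     (\<forall>u\<in>form_dom \<E>. \<forall>v\<in>form_dom \<E>. form_val \<E> u v = form_val \<E> v u) \<and>
     (\<forall>u\<in>form_dom \<E>. 0 \<le> form_val \<E> u u)"

definition shift_val ::
  "'a measure \<Rightarrow> real \<Rightarrow> 'a l2_form \<Rightarrow> ('a \<Rightarrow> real) \<Rightarrow> ('a \<Rightarrow> real) \<Rightarrow> real" where
  "shift_val M \<alpha> \<E> u v = form_val \<E> u v + \<alpha> * l2_inner M u v"

text \<open>Closedness is completeness of the domain with respect to \<open>\<E>\<^sub>1\<^bsup>1/2\<^esup>\<close>.\<close>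

definition closed_form :: "'a measure \<Rightarrow> 'a l2_form \<Rightarrow> bool" where
  "closed_form M \<E> \<longleftrightarrow>
     positive_symmetric_form M \<E> \<and>
     (\<forall>u :: nat \<Rightarrow> 'a \<Rightarrow> real.
        (\<forall>n. u n \<in> form_dom \<E>) \<and>
        (\<forall>e>0. \<exists>N. \<forall>i\<ge>N. \<forall>j\<ge>N.
           shift_val M 1 \<E> (\<lambda>x. u i x - u j x) (\<lambda>x. u i x - u j x) < e) \<longrightarrow>
        (\<exists>v\<in>form_dom \<E>.
           (\<lambda>n. shift_val M 1 \<E> (\<lambda>x. u n x - v x) (\<lambda>x. u n x - v x)) \<longlonglongrightarrow> 0))"

definition densely_defined :: "'a measure \<Rightarrow> 'a l2_form \<Rightarrow> bool" where
  "densely_defined M \<E> \<longleftrightarrow>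
     (\<forall>f\<in>L2 M. \<forall>e>0. \<exists>u\<in>form_dom \<E>. l2_norm M (\<lambda>x. f x - u x) < e)"

definition unit_contraction :: "('a \<Rightarrow> real) \<Rightarrow> 'a \<Rightarrow> real" where
  "unit_contraction u = (\<lambda>x. min (max 0 (u x)) 1)"

definition dirichlet_form :: "'a measure \<Rightarrow> 'a l2_form \<Rightarrow> bool" where
  "dirichlet_form M \<E> \<longleftrightarrow>
     closed_form M \<E> \<and> densely_defined M \<E> \<and>
     (\<forall>u\<in>form_dom \<E>.
        unit_contraction u \<in> form_dom \<E> \<and>
        form_val \<E> (unit_contraction u) (unit_contraction u) \<le> form_val \<E> u u)"

definition C_c :: "('a::topological_space \<Rightarrow> real) set" where
  "C_c = {f. continuous_on UNIV f \<and> compact (closure {x. f x \<noteq> 0})}"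

definition regular_form :: "'a::topological_space measure \<Rightarrow> 'a l2_form \<Rightarrow> bool" where
  "regular_form M \<E> \<longleftrightarrow>
     (\<forall>u\<in>form_dom \<E>. \<forall>e>0. \<exists>w\<in>form_dom \<E> \<inter> C_c.
        shift_val M 1 \<E> (\<lambda>x. u x - w x) (\<lambda>x. u x - w x) < e) \<and>
     (\<forall>f\<in>C_c. \<forall>e>0. \<exists>w\<in>form_dom \<E> \<inter> C_c. \<forall>x. \<bar>f x - w x\<bar> < e)"


section \<open>Capacity and quasi-continuity\<close>

definition capacity_open ::
  "'a::topological_space measure \<Rightarrow> 'a l2_form \<Rightarrow> 'a set \<Rightarrow> ennreal" where
  "capacity_open M \<E> U =
     (INF u\<in>{u \<in> form_dom \<E>. AE x in M. x \<in> U \<longrightarrow> 1 \<le> u x}. ennreal (shift_val M 1 \<E> u u))"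

definition capacity ::
  "'a::topological_space measure \<Rightarrow> 'a l2_form \<Rightarrow> 'a set \<Rightarrow> ennreal" where
  "capacity M \<E> A = (INF U\<in>{U. open U \<and> A \<subseteq> U}. capacity_open M \<E> U)"

definition quasi_continuous ::
  "'a::topological_space measure \<Rightarrow> 'a l2_form \<Rightarrow> ('a \<Rightarrow> real) \<Rightarrow> bool" where
  "quasi_continuous M \<E> u \<longleftrightarrow>
     (\<forall>e>0. \<exists>U. open U \<and> capacity M \<E> U < ennreal e \<and> continuous_on (- U) u)"

definition charges_no_polar_set ::
  "'a::topological_space measure \<Rightarrow> 'a l2_form \<Rightarrow> 'a measure \<Rightarrow> bool" where
  "charges_no_polar_set M \<E> \<mu> \<longleftrightarrow>
     (\<forall>N\<in>sets borel. capacity M \<E> N = 0 \<longrightarrow> emeasure \<mu> N = 0)"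


section \<open>Operators and resolvents\<close>

text \<open>
  Operators are given by their graphs.  The operator \<open>H\<close> associated with a densely defined
  closed form satisfies \<open>H u = f\<close> iff \<open>\<E>(u, v) = \<langle>f, v\<rangle>\<close> for all \<open>v\<close> in the form domain.
\<close>

definition form_operator ::
  "'a measure \<Rightarrow> 'a l2_form \<Rightarrow> (('a \<Rightarrow> real) \<times> ('a \<Rightarrow> real)) set" where
  "form_operator M \<E> =
     {(u, f). u \<in> form_dom \<E> \<and> f \<in> L2 M \<and> (\<forall>v\<in>form_dom \<E>. form_val \<E> u v = l2_inner M f v)}"

text \<open>\<open>(H + 1)\<^sup>-\<^sup>1 f\<close> is the element \<open>u\<close>, unique up to null sets, with \<open>H u = f - u\<close>.\<close>

definition resolvent1 ::
  "(('a \<Rightarrow> real) \<times> ('a \<Rightarrow> real)) set \<Rightarrow> ('a \<Rightarrow> real) \<Rightarrow> 'a \<Rightarrow> real" where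
  "resolvent1 H f = (SOME u. (u, \<lambda>x. f x - u x) \<in> H)"


section \<open>The trace form\<close>

text \<open>
  \<open>qc_dom\<close> is \<open>\<D>\<close> with all elements represented by quasi-continuous functions.
  As \<open>J u = u\<close>, the operator \<open>J\<close> appears only through its domain and through the passage
  from \<open>m\<close>-classes to \<open>\<mu>\<close>-classes.
\<close>

definition qc_dom :: "'a::topological_space measure \<Rightarrow> 'a l2_form \<Rightarrow> ('a \<Rightarrow> real) set" where
  "qc_dom m \<E> = {u \<in> form_dom \<E>. quasi_continuous m \<E> u}"

definition dom_J ::
  "'a::topological_space measure \<Rightarrow> 'a measure \<Rightarrow> 'a l2_form \<Rightarrow> ('a \<Rightarrow> real) set" where
  "dom_J m \<mu> \<E> = qc_dom m \<E> \<inter> L2 \<mu>"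

definition ker_J ::
  "'a::topological_space measure \<Rightarrow> 'a measure \<Rightarrow> 'a l2_form \<Rightarrow> ('a \<Rightarrow> real) set" where
  "ker_J m \<mu> \<E> = {u \<in> dom_J m \<mu> \<E>. AE x in \<mu>. u x = 0}"

definition ran_J ::
  "'a::topological_space measure \<Rightarrow> 'a measure \<Rightarrow> 'a l2_form \<Rightarrow> ('a \<Rightarrow> real) set" where
  "ran_J m \<mu> \<E> = {v \<in> L2 \<mu>. \<exists>u\<in>dom_J m \<mu> \<E>. AE x in \<mu>. u x = v x}"

definition ker_J_perp ::
  "'a::topological_space measure \<Rightarrow> 'a measure \<Rightarrow> 'a l2_form \<Rightarrow> real \<Rightarrow> ('a \<Rightarrow> real) set" where
  "ker_J_perp m \<mu> \<E> \<alpha> = {w \<in> qc_dom m \<E>. \<forall>k\<in>ker_J m \<mu> \<E>. shift_val m \<alpha> \<E> w k = 0}"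

definition proj_P ::
  "'a::topological_space measure \<Rightarrow> 'a measure \<Rightarrow> 'a l2_form \<Rightarrow> real \<Rightarrow> ('a \<Rightarrow> real) \<Rightarrow> 'a \<Rightarrow> real"
  where
  "proj_P m \<mu> \<E> \<alpha> u =
     (SOME w. w \<in> ker_J_perp m \<mu> \<E> \<alpha> \<and>
        (\<forall>z\<in>ker_J_perp m \<mu> \<E> \<alpha>. shift_val m \<alpha> \<E> (\<lambda>x. u x - w x) z = 0))"

definition J_preimage ::
  "'a::topological_space measure \<Rightarrow> 'a measure \<Rightarrow> 'a l2_form \<Rightarrow> ('a \<Rightarrow> real) \<Rightarrow> 'a \<Rightarrow> real" where
  "J_preimage m \<mu> \<E> v = (SOME u. u \<in> dom_J m \<mu> \<E> \<and> (AE x in \<mu>. u x = v x))"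

text \<open>
  The polarised version of \<open>J u \<mapsto> \<E>\<^sub>\<alpha>[P\<^sub>\<alpha> u]\<close>.  It does not depend on the chosen preimages,
  since two of them differ by an element of \<open>ker J\<close>.
\<close>

definition check_form ::
  "'a::topological_space measure \<Rightarrow> 'a measure \<Rightarrow> 'a l2_form \<Rightarrow> real \<Rightarrow> 'a l2_form" where
  "check_form m \<mu> \<E> \<alpha> =
     \<lparr>form_dom = ran_J m \<mu> \<E>,
      form_val = (\<lambda>v w. shift_val m \<alpha> \<E>
        (proj_P m \<mu> \<E> \<alpha> (J_preimage m \<mu> \<E> v)) (proj_P m \<mu> \<E> \<alpha> (J_preimage m \<mu> \<E> w)))\<rparr>"

text \<open>
  \<open>\<F>\<close> is the trace of \<open>\<E>\<close> with respect to \<open>J\<close>: the closed form whose associated operator is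
  the strong resolvent limit of the operators of \<open>check_form m \<mu> \<E> \<alpha>\<close> as \<open>\<alpha> \<down> 0\<close>.  This is a
  relation rather than a function because a form has many representations as an \<open>l2_form\<close>,
  differing in the values of \<open>form_val\<close> off the domain.
\<close>

definition is_trace_form ::
  "'a::topological_space measure \<Rightarrow> 'a measure \<Rightarrow> 'a l2_form \<Rightarrow> 'a l2_form \<Rightarrow> bool" where
  "is_trace_form m \<mu> \<E> \<F> \<longleftrightarrow>
     closed_form \<mu> \<F> \<and> densely_defined \<mu> \<F> \<and>
     (\<forall>f\<in>L2 \<mu>.
        ((\<lambda>\<alpha>. l2_norm \<mu> (\<lambda>x. resolvent1 (form_operator \<mu> (check_form m \<mu> \<E> \<alpha>)) f x
                            - resolvent1 (form_operator \<mu> \<F>) f x)) \<longlongrightarrow> 0) (at_right 0))"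

end

theory Submission
  imports Defs
begin


text \<open>
  For \<open>\<alpha> > 0\<close> the form \<open>check_form m \<mu> \<E> \<alpha>\<close> sends \<open>v\<close> to the least energy \<open>\<E>\<^sub>\<alpha>[w]\<close> of a
  quasi-continuous \<open>w\<close> with \<open>w = v\<close> \<open>\<mu>\<close>-almost everywhere.  Cutting off a minimiser for \<open>v\<close> at
  \<open>0\<close> and \<open>1\<close> yields a competitor for the cut-off of \<open>v\<close>, and the cut-off does not increase
  \<open>\<E>\<^sub>\<alpha>\<close>; so the unit contraction operates on every \<open>check_form m \<mu> \<E> \<alpha>\<close> (\<open>check_form_markovian\<close>).  The trace
  form is their strong resolvent limit, and this property survives such a limit
  (\<open>markovian_of_strong_resolvent_limit\<close>).

  Only convergence of the resolvents at the single point \<open>-1\<close> is available, and positivity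
  properties of one resolvent do not characterise Dirichlet forms.  The limit is therefore taken in
  the form and not in the resolvent.  A closed form \<open>F\<close> with operator \<open>H\<close> is recovered
  from \<open>H\<close> by the duality
  \<open>F[u] = sup {2\<langle>H g, u\<rangle> - F[g] | g \<in> dom H}\<close>, where finiteness of the supremum is equivalent to
  \<open>u \<in> dom F\<close> (\<open>form_le_of_dual_bound\<close>).  If \<open>G\<^sub>\<alpha> = (H\<^sub>\<alpha> + 1)\<^sup>-\<^sup>1\<close> denotes the resolvent of the
  \<open>\<alpha>\<close>-th form and \<open>T\<close> the unit contraction, duality and the contraction property of the
  \<open>\<alpha>\<close>-th form give
  \<open>2\<langle>f' - G\<^sub>\<alpha> f', T (G\<^sub>\<alpha> f)\<rangle> - \<langle>f' - G\<^sub>\<alpha> f', G\<^sub>\<alpha> f'\<rangle> \<le> \<langle>f - G\<^sub>\<alpha> f, G\<^sub>\<alpha> f\<rangle>\<close>.  All terms are continuous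
  in \<open>L\<^sup>2\<close>, so the inequality passes to the limit, and read backwards by the duality it says that
  \<open>T\<close> maps \<open>dom H\<close> into \<open>dom F\<close> without increasing \<open>F\<close>.  Approximation by elements of \<open>dom H\<close> and
  the duality once more extend this to all of \<open>dom F\<close>.

  For this argument each \<open>check_form m \<mu> \<E> \<alpha>\<close> needs its resolvent, and minimisers of the energy
  must exist.  Both follow from the closedness of \<open>J\<close> (\<open>J_closed\<close>), which rests on
  the fact that a rapidly \<open>\<E>\<^sub>1\<close>-convergent sequence of quasi-continuous functions converges
  pointwise outside a polar set to a quasi-continuous limit (\<open>quasi_uniform_limit\<close>); polar sets are
  invisible to \<open>\<mu>\<close>.  Existence statements come from one Riesz representation lemma (\<open>riesz\<close>),
  applied to several spaces of functions with semidefinite inner products.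
\<close>

section \<open>Semidefinite forms on spaces of functions\<close>

text \<open>
  Function spaces are kept as sets of functions, without passing to classes modulo null sets.
  An inner product on classes is then only semidefinite on functions, and everything below is
  formulated so that it does not see the difference.
\<close>

locale psd_form =
  fixes V :: "('a \<Rightarrow> real) set" and B :: "('a \<Rightarrow> real) \<Rightarrow> ('a \<Rightarrow> real) \<Rightarrow> real"
  assumes zero_mem: "(\<lambda>x. 0) \<in> V"
    and add_mem: "u \<in> V \<Longrightarrow> v \<in> V \<Longrightarrow> (\<lambda>x. u x + v x) \<in> V"
    and scale_mem: "u \<in> V \<Longrightarrow> (\<lambda>x. c * u x) \<in> V"
    and add_left: "u \<in> V \<Longrightarrow> v \<in> V \<Longrightarrow> w \<in> V \<Longrightarrow> B (\<lambda>x. u x + v x) w = B u w + B v w"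
    and scale_left: "u \<in> V \<Longrightarrow> w \<in> V \<Longrightarrow> B (\<lambda>x. c * u x) w = c * B u w"
    and sym: "u \<in> V \<Longrightarrow> v \<in> V \<Longrightarrow> B u v = B v u"
    and nonneg: "u \<in> V \<Longrightarrow> 0 \<le> B u u"
begin

definition nrm :: "('a \<Rightarrow> real) \<Rightarrow> real" where
  "nrm u = sqrt (B u u)"

lemma diff_mem: "u \<in> V \<Longrightarrow> v \<in> V \<Longrightarrow> (\<lambda>x. u x - v x) \<in> V"
  using add_mem[of u "\<lambda>x. (-1) * v x"] scale_mem[of v "-1"] by simp

lemma diff_left:
  "u \<in> V \<Longrightarrow> v \<in> V \<Longrightarrow> w \<in> V \<Longrightarrow> B (\<lambda>x. u x - v x) w = B u w - B v w"
  using add_left[of u "\<lambda>x. (-1) * v x" w] scale_mem[of v "-1"] scale_left[of v w "-1"] by simp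

lemma add_right: "u \<in> V \<Longrightarrow> v \<in> V \<Longrightarrow> w \<in> V \<Longrightarrow> B w (\<lambda>x. u x + v x) = B w u + B w v"
  by (simp add: sym[of w] add_mem add_left)

lemma diff_right: "u \<in> V \<Longrightarrow> v \<in> V \<Longrightarrow> w \<in> V \<Longrightarrow> B w (\<lambda>x. u x - v x) = B w u - B w v"
  by (simp add: sym[of w] diff_mem diff_left)

lemma scale_right: "u \<in> V \<Longrightarrow> w \<in> V \<Longrightarrow> B w (\<lambda>x. c * u x) = c * B w u"
  by (simp add: sym[of w] scale_mem scale_left)

lemma quad_add:
  assumes "u \<in> V" "v \<in> V"
  shows "B (\<lambda>x. u x + v x) (\<lambda>x. u x + v x) = B u u + 2 * B u v + B v v"
  using assms by (simp add: add_left add_right add_mem sym[of v u])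

lemma quad_diff:
  assumes "u \<in> V" "v \<in> V"
  shows "B (\<lambda>x. u x - v x) (\<lambda>x. u x - v x) = B u u - 2 * B u v + B v v"
  using assms by (simp add: diff_left diff_right diff_mem sym[of v u])

lemma quad_add_scale:
  assumes "u \<in> V" "v \<in> V"
  shows "B (\<lambda>x. u x + t * v x) (\<lambda>x. u x + t * v x) = B u u + 2 * t * B u v + t\<^sup>2 * B v v"
  using assms quad_add[of u "\<lambda>x. t * v x"] scale_mem[of v t]
  by (simp add: scale_left scale_right power2_eq_square)

text \<open>
  Expanding \<open>0 \<le> B[v - u]\<close>.  Equality holds for \<open>u = v\<close>, so \<open>B[v]\<close> is the supremum of the left-hand
  sides; this is the easy half of the duality on which the passage to the limit relies.
\<close>

lemma dual_bound:
  assumes "u \<in> V" "v \<in> V"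
  shows "2 * B u v - B u u \<le> B v v"
  using quad_diff[OF assms] nonneg[OF diff_mem[OF assms]] by simp

lemma nrm_nonneg [simp]: "u \<in> V \<Longrightarrow> 0 \<le> nrm u"
  by (simp add: nrm_def nonneg)

lemma nrm_square: "u \<in> V \<Longrightarrow> (nrm u)\<^sup>2 = B u u"
  by (simp add: nrm_def nonneg)

lemma nrm_le_iff: "0 \<le> s \<Longrightarrow> u \<in> V \<Longrightarrow> nrm u \<le> s \<longleftrightarrow> B u u \<le> s\<^sup>2"
  by (metis nrm_nonneg nrm_square power2_le_iff_abs_le abs_of_nonneg)

lemma cauchy_schwarz_square:
  assumes u: "u \<in> V" and v: "v \<in> V"
  shows "(B u v)\<^sup>2 \<le> B u u * B v v"
proof -
  have q: "0 \<le> B u u + 2 * t * B u v + t\<^sup>2 * B v v" for t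
    using quad_add_scale[OF u v, of t] nonneg[OF add_mem[OF u scale_mem[OF v, of t]]] by simp
  show ?thesis
  proof (cases "B v v = 0")
    case True
    have "B u v = 0"
    proof (rule ccontr)
      assume "B u v \<noteq> 0"
      then show False
        using q[of "- (B u u + 1) / (2 * B u v)"] True by (simp add: field_simps)
    qed
    then show ?thesis using True by simp
  next
    case False
    then have "0 < B v v" using nonneg[OF v] by simp
    then show ?thesis using q[of "- B u v / B v v"]
      by (simp add: field_simps power2_eq_square)
  qed
qed

lemma cauchy_schwarz:
  assumes "u \<in> V" "v \<in> V"
  shows "\<bar>B u v\<bar> \<le> nrm u * nrm v"
  using real_sqrt_le_mono[OF cauchy_schwarz_square[OF assms]]
  by (simp add: nrm_def real_sqrt_mult)

lemma nrm_add:
  assumes u: "u \<in> V" and v: "v \<in> V"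
  shows "nrm (\<lambda>x. u x + v x) \<le> nrm u + nrm v"
proof -
  have "B (\<lambda>x. u x + v x) (\<lambda>x. u x + v x) \<le> (nrm u + nrm v)\<^sup>2"
    using cauchy_schwarz[OF u v] nrm_square[OF u] nrm_square[OF v]
    by (simp add: quad_add[OF u v] power2_sum)
  then show ?thesis
    using nrm_le_iff[OF _ add_mem[OF u v], of "nrm u + nrm v"] u v by simp
qed

lemma nrm_scale: "u \<in> V \<Longrightarrow> nrm (\<lambda>x. c * u x) = \<bar>c\<bar> * nrm u"
  by (simp add: nrm_def scale_left scale_right scale_mem real_sqrt_mult
      flip: mult.assoc)

lemma nrm_diff_commute: "u \<in> V \<Longrightarrow> v \<in> V \<Longrightarrow> nrm (\<lambda>x. u x - v x) = nrm (\<lambda>x. v x - u x)"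
  using nrm_scale[OF diff_mem, of u v "-1"] by simp

lemma nrm_triangle:
  assumes "u \<in> V" "v \<in> V" "w \<in> V"
  shows "nrm (\<lambda>x. u x - w x) \<le> nrm (\<lambda>x. u x - v x) + nrm (\<lambda>x. v x - w x)"
  using nrm_add[of "\<lambda>x. u x - v x" "\<lambda>x. v x - w x"] assms by (simp add: diff_mem)

lemma null_left:
  assumes "u \<in> V" "v \<in> V" "B u u = 0"
  shows "B u v = 0"
  using cauchy_schwarz_square[OF assms(1,2)] assms(3) by simp

lemma cong_left:
  assumes "u \<in> V" "u' \<in> V" "v \<in> V" "B (\<lambda>x. u x - u' x) (\<lambda>x. u x - u' x) = 0"
  shows "B u v = B u' v"
  using null_left[OF diff_mem[OF assms(1,2)] assms(3,4)] diff_left[OF assms(1,2,3)] by simp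

lemma tendsto_form:
  assumes ev: "\<forall>\<^sub>F t in F. a t \<in> V" "\<forall>\<^sub>F t in F. b t \<in> V" and "a' \<in> V" "b' \<in> V"
    and a: "((\<lambda>t. nrm (\<lambda>x. a t x - a' x)) \<longlongrightarrow> 0) F"
    and b: "((\<lambda>t. nrm (\<lambda>x. b t x - b' x)) \<longlongrightarrow> 0) F"
  shows "((\<lambda>t. B (a t) (b t)) \<longlongrightarrow> B a' b') F"
proof -
  let ?p = "\<lambda>t. nrm (\<lambda>x. a t x - a' x)" and ?q = "\<lambda>t. nrm (\<lambda>x. b t x - b' x)"
  have "((\<lambda>t. ?p t * ?q t + nrm a' * ?q t + ?p t * nrm b') \<longlongrightarrow> 0 * 0 + nrm a' * 0 + 0 * nrm b') F"
    by (intro tendsto_intros a b)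
  then have lim: "((\<lambda>t. ?p t * ?q t + nrm a' * ?q t + ?p t * nrm b') \<longlongrightarrow> 0) F" by simp
  have "\<forall>\<^sub>F t in F. norm (B (a t) (b t) - B a' b') \<le> ?p t * ?q t + nrm a' * ?q t + ?p t * nrm b'"
    using ev
  proof eventually_elim
    case (elim t)
    note d = diff_mem[OF elim(1) \<open>a' \<in> V\<close>] diff_mem[OF elim(2) \<open>b' \<in> V\<close>]
    have "B (a t) (b t) - B a' b' = B (\<lambda>x. a t x - a' x) (\<lambda>x. b t x - b' x)
        + B a' (\<lambda>x. b t x - b' x) + B (\<lambda>x. a t x - a' x) b'"
      using elim assms(3,4) d by (simp add: diff_left diff_right)
    then show ?case
      using cauchy_schwarz[OF d] cauchy_schwarz[OF \<open>a' \<in> V\<close> d(2)]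
        cauchy_schwarz[OF d(1) \<open>b' \<in> V\<close>] by (simp add: abs_le_iff)
  qed
  then have "((\<lambda>t. B (a t) (b t) - B a' b') \<longlongrightarrow> 0) F"
    by (rule Lim_null_comparison[OF _ lim])
  then show ?thesis by (simp add: Lim_null[symmetric])
qed

lemma tendsto_form_sequence:
  assumes "\<And>n. a n \<in> V" "a' \<in> V"
    and "(\<lambda>n. B (\<lambda>x. a n x - a' x) (\<lambda>x. a n x - a' x)) \<longlonglongrightarrow> 0"
  shows "v \<in> V \<Longrightarrow> (\<lambda>n. B (a n) v) \<longlonglongrightarrow> B a' v" "(\<lambda>n. B (a n) (a n)) \<longlonglongrightarrow> B a' a'"
proof -
  have l: "(\<lambda>n. nrm (\<lambda>x. a n x - a' x)) \<longlonglongrightarrow> 0"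
    using tendsto_real_sqrt[OF assms(3)] by (simp add: nrm_def)
  show "(\<lambda>n. B (a n) (a n)) \<longlonglongrightarrow> B a' a'"
    by (rule tendsto_form[OF _ _ _ _ l l]) (auto simp: assms)
  assume v: "v \<in> V"
  have z: "nrm (\<lambda>x. 0) = 0"
    using scale_left[OF zero_mem zero_mem, of 0] by (simp add: nrm_def)
  show "(\<lambda>n. B (a n) v) \<longlonglongrightarrow> B a' v"
    by (rule tendsto_form[OF _ _ _ _ l]) (auto simp: assms v z)
qed

lemma zero_left: "v \<in> V \<Longrightarrow> B (\<lambda>x. 0) v = 0"
  using scale_left[OF zero_mem, of v 0] by simp

lemma nrm_telescope:
  assumes u: "\<And>n. u n \<in> V" and "i \<le> j"
  shows "nrm (\<lambda>x. u j x - u i x) \<le> (\<Sum>k=i..<j. nrm (\<lambda>x. u (Suc k) x - u k x))"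
  using \<open>i \<le> j\<close>
proof (induction j rule: dec_induct)
  case base
  then show ?case by (simp add: nrm_def zero_left[OF zero_mem])
next
  case (step j)
  then show ?case using nrm_triangle[OF u u u, of "Suc j" i j] by simp
qed

lemma nrm_geometric:
  assumes u: "\<And>n. u n \<in> V" and step: "\<And>n. nrm (\<lambda>x. u (Suc n) x - u n x) \<le> C / 4 ^ n"
    and "i \<le> j"
  shows "nrm (\<lambda>x. u j x - u i x) \<le> 2 * C / 4 ^ i"
proof -
  have C: "0 \<le> C" using step[of 0] nrm_nonneg[OF diff_mem[OF u u], of 1 0] by simp
  have "nrm (\<lambda>x. u j x - u i x) \<le> 2 * C / 4 ^ i - 2 * C / 4 ^ j"
    using \<open>i \<le> j\<close>
  proof (induction j rule: dec_induct)
    case base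
    then show ?case by (simp add: nrm_def zero_left[OF zero_mem])
  next
    case (step j)
    have "C / 4 ^ j \<le> 2 * C / 4 ^ j - 2 * C / 4 ^ Suc j"
      using C by (simp add: field_simps)
    then show ?case
      using nrm_triangle[OF u u u, of "Suc j" i j] assms(2)[of j] step.IH by linarith
  qed
  moreover have "0 \<le> 2 * C / 4 ^ j" using C by simp
  ultimately show ?thesis by linarith
qed

lemma summable_imp_Cauchy:
  assumes u: "\<And>n. u n \<in> V" and s: "summable (\<lambda>n. nrm (\<lambda>x. u (Suc n) x - u n x))" and "0 < e"
  shows "\<exists>N. \<forall>i\<ge>N. \<forall>j\<ge>N. B (\<lambda>x. u i x - u j x) (\<lambda>x. u i x - u j x) < e"
proof -
  let ?d = "\<lambda>n. nrm (\<lambda>x. u (Suc n) x - u n x)"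
  obtain N where N: "\<And>m n. m \<ge> N \<Longrightarrow> norm (sum ?d {m..<n}) < sqrt e"
    using s \<open>0 < e\<close> unfolding summable_Cauchy by (meson real_sqrt_gt_zero)
  have less: "nrm (\<lambda>x. u j x - u i x) < sqrt e" if "N \<le> i" "i \<le> j" for i j
    using nrm_telescope[of u, OF u that(2)] N[OF that(1), of j] by simp
  have "nrm (\<lambda>x. u i x - u j x) < sqrt e" if "N \<le> i" "N \<le> j" for i j
    using less[of i j] less[of j i] that nrm_diff_commute[OF u u, of i j] by (cases "i \<le> j") auto
  then show ?thesis by (auto simp: nrm_def)
qed

text \<open>
  Every Cauchy sequence has a subsequence with geometrically small steps, so this is completeness.
  The geometric rate is built in because, for quasi-continuous functions, it yields pointwise
  convergence outside a polar set.
\<close>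

definition complete :: bool where
  "complete \<longleftrightarrow> (\<forall>C u. (\<forall>n. u n \<in> V \<and> nrm (\<lambda>x. u (Suc n) x - u n x) \<le> C / 4 ^ n) \<longrightarrow>
     (\<exists>v\<in>V. (\<lambda>n. B (\<lambda>x. u n x - v x) (\<lambda>x. u n x - v x)) \<longlonglongrightarrow> 0))"

text \<open>
  The representing element minimises \<open>B[u] - 2 l(u)\<close>, which is bounded below because \<open>l\<close> is bounded
  with respect to \<open>B\<close>.
\<close>

lemma riesz:
  assumes "complete"
    and l_add: "\<And>u v. u \<in> V \<Longrightarrow> v \<in> V \<Longrightarrow> l (\<lambda>x. u x + v x) = l u + l v"
    and l_scale: "\<And>u c. u \<in> V \<Longrightarrow> l (\<lambda>x. c * u x) = c * l u"
    and bound: "\<And>u. u \<in> V \<Longrightarrow> (l u)\<^sup>2 \<le> K * B u u"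
  shows "\<exists>w\<in>V. \<forall>v\<in>V. B w v = l v"
proof -
  define \<Phi> where "\<Phi> u = B u u - 2 * l u" for u
  define I where "I = Inf (\<Phi> ` V)"
  \<comment> \<open>By the arithmetic-geometric mean inequality, \<open>2\<bar>l u\<bar> \<le> 2 sqrt (\<bar>K\<bar> B[u]) \<le> \<bar>K\<bar> + B[u]\<close>.\<close>
  have low: "- \<bar>K\<bar> \<le> \<Phi> u" if "u \<in> V" for u
  proof -
    have "(l u)\<^sup>2 \<le> \<bar>K\<bar> * B u u"
      using bound[OF that] nonneg[OF that] by (meson abs_ge_self mult_right_mono order_trans)
    also have "\<dots> \<le> ((\<bar>K\<bar> + B u u) / 2)\<^sup>2"
      using sum_squares_bound[of "\<bar>K\<bar>" "B u u"] by (simp add: power2_eq_square field_simps)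
    finally have "\<bar>l u\<bar> \<le> (\<bar>K\<bar> + B u u) / 2"
      using nonneg[OF that] by (simp add: abs_le_square_iff[symmetric])
    then show ?thesis by (simp add: \<Phi>_def abs_le_iff)
  qed
  then have bdd: "bdd_below (\<Phi> ` V)" by (meson bdd_belowI2)
  have I: "I \<le> \<Phi> u" if "u \<in> V" for u
    unfolding I_def by (rule cINF_lower[OF bdd that])
  \<comment> \<open>With these errors the parallelogram identity bounds \<open>B\<close> of the \<open>n\<close>-th step by \<open>1 / 16 ^ n\<close>,
    hence its norm by \<open>1 / 4 ^ n\<close>, as \<open>complete\<close> requires.\<close>
  have "\<exists>u\<in>V. \<Phi> u < I + (1 / 16 ^ n) / 4" for n :: nat
  proof -
    have "I < I + (1 / 16 ^ n) / 4" by simp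
    then show ?thesis
      using cINF_less_iff[OF _ bdd, of "I + (1 / 16 ^ n) / 4"] zero_mem unfolding I_def by blast
  qed
  then obtain u where uV: "\<And>n. u n \<in> V" and u: "\<And>n::nat. \<Phi> (u n) < I + (1 / 16 ^ n) / 4"
    by metis
  \<comment> \<open>By the parallelogram identity a minimising sequence is a Cauchy sequence.\<close>
  have par: "B (\<lambda>x. a x - b x) (\<lambda>x. a x - b x) \<le> 2 * (\<Phi> a - I) + 2 * (\<Phi> b - I)"
    if "a \<in> V" "b \<in> V" for a b
  proof -
    let ?s = "\<lambda>x. a x + b x"
    have "I \<le> \<Phi> (\<lambda>x. inverse 2 * ?s x)"
      by (rule I[OF scale_mem[OF add_mem[OF that]]])
    also have "\<dots> = (1/4) * B ?s ?s - l ?s"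
        unfolding \<Phi>_def using add_mem[OF that]
      by (simp add: scale_left[where u = ?s] scale_right[where u = ?s] scale_mem[where u = ?s]
          l_scale[where u = ?s] del: times_divide_eq_left)
    also have "\<dots> = (1/4) * (B a a + 2 * B a b + B b b) - l a - l b"
      using that by (simp add: quad_add l_add)
    finally have le: "I \<le> (1/4) * (B a a + 2 * B a b + B b b) - l a - l b" .
    have "B (\<lambda>x. a x - b x) (\<lambda>x. a x - b x) = B a a - 2 * B a b + B b b"
      using that by (rule quad_diff)
    then show ?thesis
      using le unfolding \<Phi>_def by argo
  qed
  have step: "nrm (\<lambda>x. u (Suc n) x - u n x) \<le> 1 / 4 ^ n" for n
  proof -
    have "B (\<lambda>x. u (Suc n) x - u n x) (\<lambda>x. u (Suc n) x - u n x) \<le> 1 / 16 ^ n"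
    proof -
      have arith: "b \<le> x" if "y \<le> x" "b \<le> 2 * (p - i) + 2 * (q - i)" "q < i + x / 4" "p < i + y / 4"
        for b p q i x y :: real using that by argo
      have "(1::real) / 16 ^ Suc n \<le> 1 / 16 ^ n" by (simp add: field_simps)
      then show ?thesis
        using par[OF uV uV, of "Suc n" n] u[of n] u[of "Suc n"] by (rule arith)
    qed
    also have "\<dots> = (1 / 4 ^ n)\<^sup>2"
      by (simp add: power_divide power_mult_distrib[symmetric] power2_eq_square)
    finally show ?thesis by (simp add: nrm_le_iff diff_mem uV)
  qed
  obtain w where w: "w \<in> V" and
    conv: "(\<lambda>n. B (\<lambda>x. u n x - w x) (\<lambda>x. u n x - w x)) \<longlonglongrightarrow> 0"
    using \<open>complete\<close>[unfolded complete_def, rule_format, of u 1] uV step by auto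
  have "B w v = l v" if v: "v \<in> V" for v
  proof -
    have var: "0 \<le> 2 * t * (B w v - l v) + t\<^sup>2 * B v v" for t
    proof -
      have le: "- (1 / 16 ^ n) / 4 \<le> 2 * t * (B (u n) v - l v) + t\<^sup>2 * B v v" for n
      proof -
        have "I \<le> \<Phi> (\<lambda>x. u n x + t * v x)"
          by (rule I[OF add_mem[OF uV scale_mem[OF v]]])
        also have "\<dots> = \<Phi> (u n) + 2 * t * (B (u n) v - l v) + t\<^sup>2 * B v v"
          using v uV scale_mem[OF v]
          by (simp add: \<Phi>_def quad_add_scale l_add l_scale algebra_simps)
        finally show ?thesis using u[of n] by linarith
      qed
      have lim: "(\<lambda>n. 2 * t * (B (u n) v - l v) + t\<^sup>2 * B v v)
          \<longlonglongrightarrow> 2 * t * (B w v - l v) + t\<^sup>2 * B v v"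
        by (intro tendsto_intros tendsto_form_sequence(1)[OF uV w conv v])
      have lim0: "(\<lambda>n. - (1 / 16 ^ n) / 4 :: real) \<longlonglongrightarrow> 0"
        using tendsto_mult_right_zero[OF LIMSEQ_power_zero[of "1/16::real"], of "-1/4"]
        by (simp add: power_divide mult.commute)
      show ?thesis
        by (rule LIMSEQ_le[OF lim0 lim]) (use le in blast)
    qed
    show ?thesis
    proof (rule ccontr)
      assume ne: "B w v \<noteq> l v"
      \<comment> \<open>Choose \<open>t\<close> of the sign opposite to \<open>B w v - l v\<close>; dividing by \<open>B v v + 1\<close> also covers \<open>B v v = 0\<close>.\<close>
      define d where "d = B w v - l v"
      define b where "b = B v v + 1"
      have "b > 0" "d \<noteq> 0" using nonneg[OF v] ne by (auto simp: b_def d_def)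
      have "0 \<le> 2 * (- d / b) * d + (- d / b)\<^sup>2 * B v v" using var[of "- d / b"] by (simp add: d_def)
      also have "\<dots> < 2 * (- d / b) * d + (- d / b)\<^sup>2 * b"
        using \<open>b > 0\<close> \<open>d \<noteq> 0\<close> by (simp add: b_def)
      also have "\<dots> = - d\<^sup>2 / b"
        using \<open>b > 0\<close> by (simp add: power2_eq_square field_simps)
      also have "\<dots> < 0" using \<open>b > 0\<close> \<open>d \<noteq> 0\<close> by simp
      finally show False .
    qed
  qed
  then show ?thesis using w by blast
qed

end


section \<open>Square integrable functions\<close>

lemma L2_measurable: "f \<in> L2 M \<Longrightarrow> f \<in> borel_measurable M"
  by (simp add: L2_def)

lemma L2_integrable_mult:
  assumes "f \<in> L2 M" "g \<in> L2 M"
  shows "integrable M (\<lambda>x. f x * g x)"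
proof (rule Bochner_Integration.integrable_bound)
  show "integrable M (\<lambda>x. (f x)\<^sup>2 + (g x)\<^sup>2)"
    using assms by (simp add: L2_def)
  show "(\<lambda>x. f x * g x) \<in> borel_measurable M"
    using assms by (intro borel_measurable_times L2_measurable)
  have "\<bar>a * b\<bar> \<le> a\<^sup>2 + b\<^sup>2" for a b :: real
    using sum_squares_bound[of "\<bar>a\<bar>" "\<bar>b\<bar>"] mult_nonneg_nonneg[of "\<bar>a\<bar>" "\<bar>b\<bar>"]
    unfolding abs_mult power2_abs by linarith
  then show "AE x in M. norm (f x * g x) \<le> norm ((f x)\<^sup>2 + (g x)\<^sup>2)" by simp
qed

lemma L2_add:
  assumes "f \<in> L2 M" "g \<in> L2 M"
  shows "(\<lambda>x. f x + g x) \<in> L2 M"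
proof -
  have "integrable M (\<lambda>x. (f x)\<^sup>2 + (g x)\<^sup>2 + 2 * (f x * g x))"
    using assms L2_integrable_mult[OF assms] by (simp add: L2_def)
  then show ?thesis using assms by (simp add: L2_def power2_sum mult.assoc borel_measurable_add)
qed

interpretation L2: psd_form "L2 M" "l2_inner M"
  rewrites "psd_form.nrm (l2_inner M) = l2_norm M"
  for M :: "'a measure"
proof -
  show psd: "psd_form (L2 M) (l2_inner M)"
  proof
    fix u v w :: "'a \<Rightarrow> real" and c :: real
    show "(\<lambda>x. 0) \<in> L2 M" by (simp add: L2_def)
    show "(\<lambda>x. u x + v x) \<in> L2 M" if "u \<in> L2 M" "v \<in> L2 M" using that by (rule L2_add)
    show "(\<lambda>x. c * u x) \<in> L2 M" if "u \<in> L2 M" using that by (simp add: L2_def power_mult_distrib borel_measurable_times)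
    show "l2_inner M (\<lambda>x. u x + v x) w = l2_inner M u w + l2_inner M v w"
      if "u \<in> L2 M" "v \<in> L2 M" "w \<in> L2 M"
      using that by (simp add: l2_inner_def distrib_right L2_integrable_mult)
    show "l2_inner M (\<lambda>x. c * u x) w = c * l2_inner M u w" if "u \<in> L2 M" "w \<in> L2 M"
      using that by (simp add: l2_inner_def mult.assoc)
    show "l2_inner M u v = l2_inner M v u" by (simp add: l2_inner_def mult.commute)
    show "0 \<le> l2_inner M u u" by (simp add: l2_inner_def)
  qed
  show "psd_form.nrm (l2_inner M) = l2_norm M"
    by (simp add: fun_eq_iff psd_form.nrm_def[OF psd] l2_norm_def)
qed

lemma l2_inner_cong_AE:
  assumes "f \<in> L2 M" "f' \<in> L2 M" "g \<in> L2 M" "g' \<in> L2 M"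
    and "AE x in M. f x = f' x" "AE x in M. g x = g' x"
  shows "l2_inner M f g = l2_inner M f' g'"
  unfolding l2_inner_def
proof (rule integral_cong_AE)
  show "AE x in M. f x * g x = f' x * g' x" using assms(5,6) by eventually_elim simp
qed (use assms(1-4) in \<open>auto simp: L2_def\<close>)

lemma l2_inner_self_eq_0_iff:
  assumes "f \<in> L2 M"
  shows "l2_inner M f f = 0 \<longleftrightarrow> (AE x in M. f x = 0)"
  using integral_nonneg_eq_0_iff_AE[OF L2_integrable_mult[OF assms assms]]
  by (simp add: l2_inner_def)

text \<open>
  Applied to differences from a fixed function, this identifies an almost everywhere limit with a
  limit in norm.
\<close>

lemma L2_Fatou:
  assumes f: "\<And>n. f n \<in> L2 M" and g: "g \<in> borel_measurable M"
    and lim: "AE x in M. (\<lambda>n. f n x) \<longlonglongrightarrow> g x"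
    and bound: "\<forall>\<^sub>F n in sequentially. l2_inner M (f n) (f n) \<le> C"
  shows "g \<in> L2 M" "l2_inner M g g \<le> C"
proof -
  have C: "0 \<le> C"
    using eventually_happens'[OF sequentially_bot bound] L2.nonneg[OF f] order_trans by blast
  have fn: "(\<integral>\<^sup>+x. ennreal ((f n x)\<^sup>2) \<partial>M) = ennreal (l2_inner M (f n) (f n))" for n
    using f[of n] nn_integral_eq_integral[of M "\<lambda>x. (f n x)\<^sup>2"]
    by (simp add: L2_def l2_inner_def power2_eq_square)
  have "(\<integral>\<^sup>+x. ennreal ((g x)\<^sup>2) \<partial>M) = (\<integral>\<^sup>+x. liminf (\<lambda>n. ennreal ((f n x)\<^sup>2)) \<partial>M)"
  proof (rule nn_integral_cong_AE)
    show "AE x in M. ennreal ((g x)\<^sup>2) = liminf (\<lambda>n. ennreal ((f n x)\<^sup>2))"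
      using lim
    proof eventually_elim
      case (elim x)
      have "(\<lambda>n. ennreal ((f n x)\<^sup>2)) \<longlonglongrightarrow> ennreal ((g x)\<^sup>2)"
        by (intro tendsto_ennrealI tendsto_intros elim)
      then show ?case by (rule lim_imp_Liminf[OF sequentially_bot, symmetric])
    qed
  qed
  also have "\<dots> \<le> liminf (\<lambda>n. \<integral>\<^sup>+x. ennreal ((f n x)\<^sup>2) \<partial>M)"
    by (rule nn_integral_liminf) (use f in \<open>auto simp: L2_def\<close>)
  also have "\<dots> \<le> ennreal C"
  proof -
    have "liminf (\<lambda>n. \<integral>\<^sup>+x. ennreal ((f n x)\<^sup>2) \<partial>M) \<le> liminf (\<lambda>n. ennreal C)"
      by (rule Liminf_mono) (use bound in \<open>auto simp: fn elim!: eventually_mono intro: ennreal_leI\<close>)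
    then show ?thesis by (simp add: Liminf_const)
  qed
  finally have le: "(\<integral>\<^sup>+x. ennreal ((g x)\<^sup>2) \<partial>M) \<le> ennreal C" .
  have int: "integrable M (\<lambda>x. (g x)\<^sup>2)"
    by (rule integrableI_nonneg) (use g le in \<open>auto simp: le_less_trans[OF le ennreal_less_top]\<close>)
  then show "g \<in> L2 M" using g by (simp add: L2_def)
  have "ennreal (\<integral>x. (g x)\<^sup>2 \<partial>M) \<le> ennreal C"
    using le nn_integral_eq_integral[OF int] by simp
  then show "l2_inner M g g \<le> C" using C by (simp add: l2_inner_def power2_eq_square)
qed

lemma L2_dominated:
  assumes f: "f \<in> L2 M" and g: "g \<in> borel_measurable M" and le: "AE x in M. \<bar>g x\<bar> \<le> \<bar>f x\<bar>"
  shows "g \<in> L2 M" "l2_inner M g g \<le> l2_inner M f f"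
proof -
  have sq: "AE x in M. (g x)\<^sup>2 \<le> (f x)\<^sup>2"
    using le by eventually_elim (simp add: abs_le_square_iff)
  have "integrable M (\<lambda>x. (g x)\<^sup>2)"
    by (rule Bochner_Integration.integrable_bound[of M "\<lambda>x. (f x)\<^sup>2"])
      (use f g sq in \<open>auto simp: L2_def\<close>)
  then show "g \<in> L2 M" using g by (simp add: L2_def)
  then show "l2_inner M g g \<le> l2_inner M f f"
    unfolding l2_inner_def using f sq
    by (intro integral_mono_AE) (auto simp: L2_integrable_mult power2_eq_square)
qed

text \<open>
  The positive part of \<open>h - g\<close> is dominated by \<open>\<bar>f n - g\<bar>\<close> as soon as \<open>h \<le> f n\<close>, so its norm vanishes.
\<close>

lemma AE_le_L2_limit:
  assumes f: "\<And>n. f n \<in> L2 M" and g: "g \<in> L2 M" and h: "h \<in> L2 M"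
    and lim: "(\<lambda>n. l2_inner M (\<lambda>x. f n x - g x) (\<lambda>x. f n x - g x)) \<longlonglongrightarrow> 0"
    and le: "\<forall>\<^sub>F n in sequentially. AE x in M. h x \<le> f n x"
  shows "AE x in M. h x \<le> g x"
proof -
  let ?p = "\<lambda>x. max 0 (h x - g x)"
  have pm: "?p \<in> borel_measurable M"
    by (intro borel_measurable_max borel_measurable_const borel_measurable_diff L2_measurable g h)
  have p: "?p \<in> L2 M" by (rule L2_dominated[OF L2.diff_mem[OF h g] pm]) auto
  have "\<forall>\<^sub>F n in sequentially. l2_inner M ?p ?p \<le> l2_inner M (\<lambda>x. f n x - g x) (\<lambda>x. f n x - g x)"
    using le
  proof eventually_elim
    case (elim n)
    then have "AE x in M. \<bar>?p x\<bar> \<le> \<bar>f n x - g x\<bar>" by eventually_elim auto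
    then show ?case by (rule L2_dominated(2)[OF L2.diff_mem[OF f g] pm])
  qed
  then have "l2_inner M ?p ?p \<le> 0"
    by (rule tendsto_lowerbound[OF lim _ sequentially_bot])
  then have "l2_inner M ?p ?p = 0" using L2.nonneg[OF p] by linarith
  then have "AE x in M. ?p x = 0" using l2_inner_self_eq_0_iff[OF p] by simp
  then show ?thesis by eventually_elim (simp add: max_def split: if_splits)
qed

lemma unit_contraction_measurable:
  "f \<in> borel_measurable M \<Longrightarrow> unit_contraction f \<in> borel_measurable M"
  unfolding unit_contraction_def
  by (intro borel_measurable_min borel_measurable_max borel_measurable_const)

lemma unit_contraction_range: "0 \<le> unit_contraction f x" "unit_contraction f x \<le> 1"
  by (auto simp: unit_contraction_def)

lemma unit_contraction_eq_1: "1 \<le> f x \<Longrightarrow> unit_contraction f x = 1"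
  by (auto simp: unit_contraction_def)

lemma unit_contraction_L2:
  assumes "f \<in> L2 M"
  shows "unit_contraction f \<in> L2 M"
    and "l2_inner M (unit_contraction f) (unit_contraction f) \<le> l2_inner M f f"
proof -
  have "AE x in M. \<bar>unit_contraction f x\<bar> \<le> \<bar>f x\<bar>" by (simp add: unit_contraction_def)
  note d = L2_dominated[OF assms unit_contraction_measurable[OF L2_measurable[OF assms]] this]
  show "unit_contraction f \<in> L2 M"
    and "l2_inner M (unit_contraction f) (unit_contraction f) \<le> l2_inner M f f" by (fact d)+
qed

lemma unit_contraction_nonexpansive:
  assumes f: "f \<in> L2 M" and g: "g \<in> L2 M"
  shows "l2_norm M (\<lambda>x. unit_contraction f x - unit_contraction g x) \<le> l2_norm M (\<lambda>x. f x - g x)"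
proof -
  have "(\<lambda>x. unit_contraction f x - unit_contraction g x) \<in> borel_measurable M"
    by (intro borel_measurable_diff unit_contraction_measurable L2_measurable f g)
  moreover have "AE x in M. \<bar>unit_contraction f x - unit_contraction g x\<bar> \<le> \<bar>f x - g x\<bar>"
    by (auto simp: unit_contraction_def)
  ultimately show ?thesis
    unfolding l2_norm_def by (intro real_sqrt_le_mono L2_dominated(2) L2.diff_mem f g)
qed

text \<open>
  Stated for arbitrary filters, since it is applied both along \<open>\<alpha> \<down> 0\<close> and along sequences.
\<close>

lemma unit_contraction_tendsto:
  assumes "\<forall>\<^sub>F t in F. f t \<in> L2 M" "g \<in> L2 M"
    and lim: "((\<lambda>t. l2_norm M (\<lambda>x. f t x - g x)) \<longlongrightarrow> 0) F"
  shows "((\<lambda>t. l2_norm M (\<lambda>x. unit_contraction (f t) x - unit_contraction g x)) \<longlongrightarrow> 0) F"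
proof (rule Lim_null_comparison[OF _ lim])
  show "\<forall>\<^sub>F t in F. norm (l2_norm M (\<lambda>x. unit_contraction (f t) x - unit_contraction g x))
      \<le> l2_norm M (\<lambda>x. f t x - g x)"
    using assms(1)
  proof eventually_elim
    case (elim t)
    have "0 \<le> l2_norm M (\<lambda>x. unit_contraction (f t) x - unit_contraction g x)"
      by (intro L2.nrm_nonneg L2.diff_mem unit_contraction_L2 elim assms(2))
    then show ?case using unit_contraction_nonexpansive[OF elim assms(2)] by simp
  qed
qed


section \<open>Closed forms and their operators\<close>

lemma positive_symmetric_psd:
  assumes "positive_symmetric_form M E"
  shows "psd_form (form_dom E) (form_val E)"
proof -
  note a = assms[unfolded positive_symmetric_form_def]
  show ?thesis
    by unfold_locales (use a in blast)+
qed

lemma form_dom_L2: "positive_symmetric_form M E \<Longrightarrow> u \<in> form_dom E \<Longrightarrow> u \<in> L2 M"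
  unfolding positive_symmetric_form_def by blast

lemma form_dom_saturated:
  "positive_symmetric_form M E \<Longrightarrow> u \<in> form_dom E \<Longrightarrow> v \<in> L2 M \<Longrightarrow> (AE x in M. u x = v x)
    \<Longrightarrow> v \<in> form_dom E"
  unfolding positive_symmetric_form_def by blast

lemma form_val_cong_AE:
  "positive_symmetric_form M E \<Longrightarrow> u \<in> form_dom E \<Longrightarrow> v \<in> form_dom E \<Longrightarrow> w \<in> form_dom E \<Longrightarrow>
    (AE x in M. u x = v x) \<Longrightarrow> form_val E u w = form_val E v w"
  unfolding positive_symmetric_form_def by blast

text \<open>
  Used with \<open>L\<^sup>2\<close> as the second space for \<open>\<E>\<^sub>\<alpha>\<close>, and with \<open>L\<^sup>2(\<mu>)\<close> for the graph norm of \<open>J\<close>.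
\<close>

lemma psd_form_add_scaled:
  assumes B: "psd_form V B" and C: "psd_form W C" and sub: "V \<subseteq> W" and "0 \<le> c"
  shows "psd_form V (\<lambda>u v. B u v + c * C u v)"
proof -
  interpret B: psd_form V B by (rule B)
  interpret C: psd_form W C by (rule C)
  show ?thesis
  proof
    fix u v w :: "'a \<Rightarrow> real" and a :: real
    show "(\<lambda>x. 0) \<in> V" by (rule B.zero_mem)
    show "(\<lambda>x. a * u x) \<in> V" if "u \<in> V" using that by (rule B.scale_mem)
    show "(\<lambda>x. u x + v x) \<in> V" if "u \<in> V" "v \<in> V" using that by (rule B.add_mem)
    show "B (\<lambda>x. u x + v x) w + c * C (\<lambda>x. u x + v x) w
        = B u w + c * C u w + (B v w + c * C v w)" if "u \<in> V" "v \<in> V" "w \<in> V"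
      using that sub by (simp add: B.add_left C.add_left subsetD algebra_simps)
    show "B (\<lambda>x. a * u x) w + c * C (\<lambda>x. a * u x) w = a * (B u w + c * C u w)"
      if "u \<in> V" "w \<in> V"
      using that sub by (simp add: B.scale_left C.scale_left subsetD algebra_simps)
    show "B u v + c * C u v = B v u + c * C v u" if "u \<in> V" "v \<in> V"
      using that sub by (simp add: B.sym[of u v] C.sym[of u v] subsetD)
    show "0 \<le> B u u + c * C u u" if "u \<in> V"
      using that sub \<open>0 \<le> c\<close> by (simp add: B.nonneg C.nonneg subsetD)
  qed
qed

lemma psd_form_subspace:
  assumes "psd_form W B" "V \<subseteq> W" "(\<lambda>x. 0) \<in> V"
    and "\<And>u v. u \<in> V \<Longrightarrow> v \<in> V \<Longrightarrow> (\<lambda>x. u x + v x) \<in> V"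
    and "\<And>u c. u \<in> V \<Longrightarrow> (\<lambda>x. c * u x) \<in> V"
  shows "psd_form V B"
proof -
  interpret psd_form W B by (rule assms(1))
  show ?thesis
    by unfold_locales
      (use assms(2-) in \<open>auto simp: subsetD add_left scale_left intro: sym nonneg\<close>)
qed

lemma shift_psd:
  assumes "positive_symmetric_form M E" "0 \<le> \<alpha>"
  shows "psd_form (form_dom E) (shift_val M \<alpha> E)"
proof -
  have "shift_val M \<alpha> E = (\<lambda>u v. form_val E u v + \<alpha> * l2_inner M u v)"
    by (simp add: fun_eq_iff shift_val_def)
  then show ?thesis
    using psd_form_add_scaled[OF positive_symmetric_psd[OF assms(1)] L2.psd_form_axioms _ assms(2)]
      form_dom_L2[OF assms(1)] by auto
qed

lemma shift_val_cong_AE: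
  assumes E: "positive_symmetric_form M E" and u: "u \<in> form_dom E" and v: "v \<in> form_dom E"
    and ae: "AE x in M. u x = v x"
  shows "shift_val M \<alpha> E u u = shift_val M \<alpha> E v v"
proof -
  interpret psd_form "form_dom E" "form_val E" by (rule positive_symmetric_psd[OF E])
  have "form_val E u u = form_val E v u" "form_val E u v = form_val E v v"
    using form_val_cong_AE[OF E u v _ ae] u v by auto
  moreover have "l2_inner M u u = l2_inner M v v"
    using form_dom_L2[OF E] u v ae by (intro l2_inner_cong_AE) auto
  ultimately show ?thesis using sym[OF u v] by (simp add: shift_val_def)
qed

text \<open>
  For positive parameters the norms \<open>\<E>\<^sub>\<alpha>\<^bsup>1/2\<^esup>\<close> are all equivalent; closedness and capacity refer to
  \<open>\<E>\<^sub>1\<close>, the trace form at \<open>\<alpha>\<close> to \<open>\<E>\<^sub>\<alpha>\<close>.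
\<close>

lemma shift_val_le:
  assumes E: "positive_symmetric_form M E" and "0 < \<alpha>" "0 \<le> \<beta>" and u: "u \<in> form_dom E"
  shows "shift_val M \<beta> E u u \<le> max 1 (\<beta> / \<alpha>) * shift_val M \<alpha> E u u"
proof -
  interpret psd_form "form_dom E" "form_val E" by (rule positive_symmetric_psd[OF E])
  let ?K = "max 1 (\<beta> / \<alpha>)"
  have "1 * form_val E u u \<le> ?K * form_val E u u"
    by (rule mult_right_mono) (auto simp: nonneg u)
  moreover have "(\<beta> / \<alpha>) * (\<alpha> * l2_inner M u u) \<le> ?K * (\<alpha> * l2_inner M u u)"
    using \<open>0 < \<alpha>\<close> L2.nonneg[OF form_dom_L2[OF E u]] by (intro mult_right_mono) auto
  ultimately show ?thesis using \<open>0 < \<alpha>\<close> by (simp add: shift_val_def distrib_left)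
qed

lemma shift_nrm_le:
  assumes E: "positive_symmetric_form M E" and "0 < \<alpha>" "0 \<le> \<beta>" and u: "u \<in> form_dom E"
  shows "psd_form.nrm (shift_val M \<beta> E) u
      \<le> sqrt (max 1 (\<beta> / \<alpha>)) * psd_form.nrm (shift_val M \<alpha> E) u"
  using real_sqrt_le_mono[OF shift_val_le[OF assms]] \<open>0 < \<alpha>\<close> \<open>0 \<le> \<beta>\<close>
  by (simp add: psd_form.nrm_def[OF shift_psd[OF E]] real_sqrt_mult)

lemma shift_val_tendsto_0:
  assumes E: "positive_symmetric_form M E" and "0 < \<alpha>" "0 \<le> \<beta>" and u: "\<And>n. u n \<in> form_dom E"
    and lim: "(\<lambda>n. shift_val M \<alpha> E (u n) (u n)) \<longlonglongrightarrow> 0"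
  shows "(\<lambda>n. shift_val M \<beta> E (u n) (u n)) \<longlonglongrightarrow> 0"
proof (rule Lim_null_comparison)
  show "\<forall>\<^sub>F n in sequentially. norm (shift_val M \<beta> E (u n) (u n))
      \<le> max 1 (\<beta> / \<alpha>) * shift_val M \<alpha> E (u n) (u n)"
    using shift_val_le[OF assms(1-3) u] psd_form.nonneg[OF shift_psd[OF E \<open>0 \<le> \<beta>\<close>] u]
    by (intro always_eventually allI) simp
  show "(\<lambda>n. max 1 (\<beta> / \<alpha>) * shift_val M \<alpha> E (u n) (u n)) \<longlonglongrightarrow> 0"
    by (rule tendsto_mult_right_zero[OF lim])
qed

lemma closed_form_summable_limit:
  assumes E: "closed_form M E" and u: "\<And>n. u n \<in> form_dom E"
    and s: "summable (\<lambda>n. psd_form.nrm (shift_val M 1 E) (\<lambda>x. u (Suc n) x - u n x))"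
  shows "\<exists>v\<in>form_dom E. (\<lambda>n. shift_val M 1 E (\<lambda>x. u n x - v x) (\<lambda>x. u n x - v x)) \<longlonglongrightarrow> 0"
proof -
  interpret psd_form "form_dom E" "shift_val M 1 E"
    using E shift_psd[of M E 1] by (simp add: closed_form_def)
  have "\<forall>e>0. \<exists>N. \<forall>i\<ge>N. \<forall>j\<ge>N.
      shift_val M 1 E (\<lambda>x. u i x - u j x) (\<lambda>x. u i x - u j x) < e"
    using summable_imp_Cauchy[of u, OF u s] by blast
  then show ?thesis using E u unfolding closed_form_def by blast
qed

lemma closed_form_complete:
  assumes E: "closed_form M E" and "0 < \<alpha>"
  shows "psd_form.complete (form_dom E) (shift_val M \<alpha> E)"
proof -
  have ps: "positive_symmetric_form M E" using E by (simp add: closed_form_def)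
  interpret A: psd_form "form_dom E" "shift_val M \<alpha> E" using ps \<open>0 < \<alpha>\<close> by (simp add: shift_psd)
  interpret O: psd_form "form_dom E" "shift_val M 1 E" using ps by (simp add: shift_psd)
  show ?thesis
    unfolding A.complete_def
  proof (intro allI impI)
    fix C :: real and u
    assume a: "\<forall>n. u n \<in> form_dom E \<and> A.nrm (\<lambda>x. u (Suc n) x - u n x) \<le> C / 4 ^ n"
    then have u: "u n \<in> form_dom E" for n by simp
    define K where "K = max 1 (1 / \<alpha>)"
    have le: "O.nrm (\<lambda>x. u (Suc n) x - u n x) \<le> sqrt K * (C / 4 ^ n)" for n
    proof -
      let ?d = "\<lambda>x. u (Suc n) x - u n x"
      have "O.nrm ?d \<le> sqrt K * A.nrm ?d"
        unfolding K_def by (rule shift_nrm_le[OF ps \<open>0 < \<alpha>\<close> zero_le_one A.diff_mem[OF u u]])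
      also have "\<dots> \<le> sqrt K * (C / 4 ^ n)"
        by (rule mult_left_mono[OF conjunct2[OF spec[OF a]]]) (simp add: K_def)
      finally show ?thesis .
    qed
    have "summable (\<lambda>n. sqrt K * (C / 4 ^ n))"
      using summable_mult[OF summable_geometric[of "1/4::real"], of "sqrt K * C"]
      by (simp add: power_divide)
    then have "summable (\<lambda>n. O.nrm (\<lambda>x. u (Suc n) x - u n x))"
      by (rule summable_comparison_test'[of "\<lambda>n. sqrt K * (C / 4 ^ n)" 0])
        (use le in \<open>simp add: O.diff_mem u\<close>)
    from closed_form_summable_limit[of M E u, OF E u this] obtain v where v: "v \<in> form_dom E"
      and lim: "(\<lambda>n. shift_val M 1 E (\<lambda>x. u n x - v x) (\<lambda>x. u n x - v x)) \<longlonglongrightarrow> 0" by blast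
    have "(\<lambda>n. shift_val M \<alpha> E (\<lambda>x. u n x - v x) (\<lambda>x. u n x - v x)) \<longlonglongrightarrow> 0"
      using \<open>0 < \<alpha>\<close> by (intro shift_val_tendsto_0[OF ps zero_less_one _ _ lim] A.diff_mem u v) simp
    with v show "\<exists>v\<in>form_dom E.
        (\<lambda>n. shift_val M \<alpha> E (\<lambda>x. u n x - v x) (\<lambda>x. u n x - v x)) \<longlonglongrightarrow> 0" by blast
  qed
qed

text \<open>
  The function \<open>g = c (H + c)\<^sup>-\<^sup>1 u\<close>, obtained by representing \<open>v \<mapsto> c \<langle>u, v\<rangle>\<close> with respect to
  \<open>F + c \<langle>_, _\<rangle>\<close>.
\<close>

lemma yosida_approximant:
  assumes F: "closed_form M F" and "0 < c" and u: "u \<in> L2 M"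
  obtains g where "g \<in> form_dom F"
    "\<And>v. v \<in> form_dom F \<Longrightarrow> form_val F g v = c * l2_inner M (\<lambda>x. u x - g x) v"
proof -
  have ps: "positive_symmetric_form M F" using F by (simp add: closed_form_def)
  interpret F: psd_form "form_dom F" "form_val F" by (rule positive_symmetric_psd[OF ps])
  interpret S: psd_form "form_dom F" "shift_val M c F" using ps \<open>0 < c\<close> by (simp add: shift_psd)
  note D = form_dom_L2[OF ps]
  have "\<exists>g\<in>form_dom F. \<forall>v\<in>form_dom F. shift_val M c F g v = c * l2_inner M u v"
  proof (rule S.riesz[OF closed_form_complete[OF F \<open>0 < c\<close>], where K = "c * l2_inner M u u"])
    fix v w :: "'a \<Rightarrow> real" and a :: real assume v: "v \<in> form_dom F"
    show "c * l2_inner M u (\<lambda>x. v x + w x) = c * l2_inner M u v + c * l2_inner M u w"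
      if "w \<in> form_dom F" using u v that D by (simp add: L2.add_right distrib_left)
    show "c * l2_inner M u (\<lambda>x. a * v x) = a * (c * l2_inner M u v)"
      using u v D by (simp add: L2.scale_right)
    have "(l2_inner M u v)\<^sup>2 \<le> l2_inner M u u * l2_inner M v v"
      using L2.cauchy_schwarz_square[OF u D[OF v]] .
    then have "(c * l2_inner M u v)\<^sup>2 \<le> c * l2_inner M u u * (c * l2_inner M v v)"
      using \<open>0 < c\<close> by (simp add: power_mult_distrib power2_eq_square mult_left_mono algebra_simps)
    also have "\<dots> \<le> c * l2_inner M u u * shift_val M c F v v"
      using \<open>0 < c\<close> L2.nonneg[OF u] F.nonneg[OF v]
      by (intro mult_left_mono) (auto simp: shift_val_def)
    finally show "(c * l2_inner M u v)\<^sup>2 \<le> c * l2_inner M u u * shift_val M c F v v" .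
  qed
  then obtain g where g: "g \<in> form_dom F"
    and eq: "\<And>v. v \<in> form_dom F \<Longrightarrow> shift_val M c F g v = c * l2_inner M u v" by blast
  show thesis
  proof (rule that[OF g])
    fix v assume "v \<in> form_dom F"
    then show "form_val F g v = c * l2_inner M (\<lambda>x. u x - g x) v"
      using eq[of v] u D g by (simp add: shift_val_def L2.diff_left right_diff_distrib)
  qed
qed

lemma yosida_in_form_operator:
  assumes F: "positive_symmetric_form M F" and "u \<in> L2 M" and g: "g \<in> form_dom F"
    and eq: "\<And>v. v \<in> form_dom F \<Longrightarrow> form_val F g v = c * l2_inner M (\<lambda>x. u x - g x) v"
  shows "(g, \<lambda>x. c * (u x - g x)) \<in> form_operator M F"
proof -
  note d = L2.diff_mem[OF \<open>u \<in> L2 M\<close> form_dom_L2[OF F g]]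
  show ?thesis
    using g eq L2.scale_mem[OF d] L2.scale_left[OF d form_dom_L2[OF F]]
    by (auto simp: form_operator_def)
qed

text \<open>
  The functions \<open>g n = c (H + c)\<^sup>-\<^sup>1 u\<close> with \<open>c = n + 1\<close> lie in \<open>dom H\<close> with \<open>H (g n) = c (u - g n)\<close>.
  Inserting \<open>g n\<close> into the hypothesis turns it into \<open>F[g n] + 2 c \<parallel>u - g n\<parallel>\<^sup>2 \<le> C\<close>, and this contains
  both the bound on the form and the convergence.
\<close>

lemma yosida_sequence:
  assumes F: "closed_form M F" and u: "u \<in> L2 M"
    and dual: "\<And>g h. (g, h) \<in> form_operator M F \<Longrightarrow> 2 * l2_inner M h u - form_val F g g \<le> C"
  obtains g where "\<And>n. g n \<in> form_dom F"
    "\<And>n v. v \<in> form_dom F \<Longrightarrow>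
      form_val F (g n) v = real (Suc n) * l2_inner M (\<lambda>x. u x - g n x) v"
    "\<And>n. form_val F (g n) (g n) \<le> C"
    "(\<lambda>n. l2_inner M (\<lambda>x. u x - g n x) (\<lambda>x. u x - g n x)) \<longlonglongrightarrow> 0"
proof -
  have ps: "positive_symmetric_form M F" using F by (simp add: closed_form_def)
  interpret F: psd_form "form_dom F" "form_val F" by (rule positive_symmetric_psd[OF ps])
  note D = form_dom_L2[OF ps]
  have "\<exists>g. g \<in> form_dom F \<and>
      (\<forall>v\<in>form_dom F. form_val F g v = real (Suc n) * l2_inner M (\<lambda>x. u x - g x) v)" for n
    by (rule yosida_approximant[OF F _ u, of "real (Suc n)"]) auto
  then obtain g where g: "\<And>n. g n \<in> form_dom F" and
    eq: "\<And>n v. v \<in> form_dom F \<Longrightarrow>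
      form_val F (g n) v = real (Suc n) * l2_inner M (\<lambda>x. u x - g n x) v"
    by metis
  define r where "r n = (\<lambda>x. u x - g n x)" for n
  have r: "r n \<in> L2 M" for n unfolding r_def by (intro L2.diff_mem u D g)
  define d where "d n = l2_inner M (r n) (r n)" for n
  have d0: "0 \<le> d n" for n by (simp add: d_def L2.nonneg r)
  have Fd: "form_val F (g n) (g n) + 2 * (real (Suc n) * d n) \<le> C" for n
  proof -
    have "2 * l2_inner M (\<lambda>x. real (Suc n) * r n x) u - form_val F (g n) (g n) \<le> C"
      unfolding r_def by (rule dual[OF yosida_in_form_operator[OF ps u g eq]])
    moreover have "l2_inner M (\<lambda>x. real (Suc n) * r n x) u = real (Suc n) * l2_inner M (r n) u"
      by (rule L2.scale_left[OF r u])
    moreover have "l2_inner M (r n) u = d n + l2_inner M (r n) (g n)"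
      using L2.add_right[OF r D[OF g] r, of n n n] by (simp add: d_def r_def)
    moreover have "form_val F (g n) (g n) = real (Suc n) * l2_inner M (r n) (g n)"
      using eq[OF g, of n n] by (simp add: r_def)
    ultimately show ?thesis by (simp add: distrib_left)
  qed
  have Fle: "form_val F (g n) (g n) \<le> C" for n using Fd[of n] d0[of n]
    by (smt (verit) mult_nonneg_nonneg of_nat_0_le_iff)
  have C0: "0 \<le> C" using Fle[of 0] F.nonneg[OF g, of 0] by linarith
  have d_le: "d n \<le> C / real (Suc n)" for n
  proof -
    have "2 * (real (Suc n) * d n) \<le> C" using Fd[of n] F.nonneg[OF g, of n] by linarith
    then have "real (Suc n) * d n \<le> C" using C0 by linarith
    then show ?thesis by (simp add: field_simps)
  qed
  have d_lim: "d \<longlonglongrightarrow> 0"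
  proof (rule Lim_null_comparison)
    show "\<forall>\<^sub>F n in sequentially. norm (d n) \<le> C * inverse (real (Suc n))"
      using d_le d0 by (simp add: divide_inverse)
    show "(\<lambda>n. C * inverse (real (Suc n))) \<longlonglongrightarrow> 0"
      by (rule tendsto_mult_right_zero[OF LIMSEQ_inverse_real_of_nat])
  qed
  show thesis
    by (rule that[OF g eq Fle d_lim[unfolded d_def r_def]])
qed

text \<open>
  The hard half of the duality between a closed form and its operator: an upper bound on
  \<open>2\<langle>H g, u\<rangle> - F[g]\<close> over the operator domain already forces \<open>u\<close> into the form domain.  The
  approximants \<open>g n\<close> converge to \<open>u\<close> in \<open>L\<^sup>2\<close> with bounded form values; as these values increase with
  \<open>n\<close>, the sequence is Cauchy for the form, and closedness applies.
\<close>

lemma form_le_of_dual_bound: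
  assumes F: "closed_form M F" and u: "u \<in> L2 M"
    and dual: "\<And>g h. (g, h) \<in> form_operator M F \<Longrightarrow> 2 * l2_inner M h u - form_val F g g \<le> C"
  shows "u \<in> form_dom F" "form_val F u u \<le> C"
proof -
  have ps: "positive_symmetric_form M F" using F by (simp add: closed_form_def)
  interpret F: psd_form "form_dom F" "form_val F" by (rule positive_symmetric_psd[OF ps])
  note D = form_dom_L2[OF ps]
  obtain g where g: "\<And>n. g n \<in> form_dom F" and
    eq: "\<And>n v. v \<in> form_dom F \<Longrightarrow>
      form_val F (g n) v = real (Suc n) * l2_inner M (\<lambda>x. u x - g n x) v" and
    Fle: "\<And>n. form_val F (g n) (g n) \<le> C" and
    lim0: "(\<lambda>n. l2_inner M (\<lambda>x. u x - g n x) (\<lambda>x. u x - g n x)) \<longlonglongrightarrow> 0"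
    by (rule yosida_sequence[OF F u dual]) blast+
  define r where "r n = (\<lambda>x. u x - g n x)" for n
  have r: "r n \<in> L2 M" for n unfolding r_def by (intro L2.diff_mem u D g)
  define d where "d n = l2_inner M (r n) (r n)" for n
  have d_lim: "d \<longlonglongrightarrow> 0" using lim0 by (simp add: d_def[abs_def] r_def)
  \<comment> \<open>The values \<open>F[g n]\<close> increase, and their increments dominate \<open>F[g j - g i]\<close>.\<close>
  have incr: "form_val F (\<lambda>x. g j x - g i x) (\<lambda>x. g j x - g i x)
      \<le> form_val F (g j) (g j) - form_val F (g i) (g i)" if "i \<le> j" for i j
  proof -
    define a where "a = real (Suc i)"
    define b where "b = real (Suc j)"
    define p where "p = l2_inner M (r i) (r j)"
    have ab: "0 < a" "a \<le> b" using that by (auto simp: a_def b_def)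
    have dg: "(\<lambda>x. g j x - g i x) = (\<lambda>x. r i x - r j x)" by (simp add: r_def)
    have gm: "(\<lambda>x. g j x - g i x) \<in> form_dom F" by (intro F.diff_mem g)
    have i: "form_val F (g i) (\<lambda>x. g j x - g i x) = a * (d i - p)"
      using eq[OF gm, of i] unfolding dg
      by (simp add: a_def r_def[symmetric] L2.diff_right r d_def p_def)
    have j: "form_val F (g j) (\<lambda>x. g j x - g i x) = b * (p - d j)"
      using eq[OF gm, of j] unfolding dg
      by (simp add: b_def r_def[symmetric] L2.diff_right r d_def p_def L2.sym[OF r r, of j i])
    have "0 \<le> b * (p - d j) - a * (d i - p)"
      using F.nonneg[OF gm] F.diff_left[OF g g gm, of j i] i j by simp
    then have 1: "b * d j + a * d i \<le> (a + b) * p" by (simp add: algebra_simps)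
    have 2: "2 * p \<le> d i + d j"
      using L2.nonneg[OF L2.diff_mem[OF r r], of i j] by (simp add: L2.quad_diff r d_def p_def)
    \<comment> \<open>\<open>1\<close> expresses \<open>F[g j - g i] \<ge> 0\<close>.  Together with \<open>2\<close> it shows that the distances \<open>d\<close> decrease.\<close>
    have "p \<le> d i"
    proof (cases "i = j")
      case True
      then show ?thesis by (simp add: p_def d_def)
    next
      case False
      then have "a < b" using that by (simp add: a_def b_def)
      have "(a + b) * (2 * p) \<le> (a + b) * (d i + d j)"
        using 2 ab by (intro mult_left_mono) auto
      then have "(b - a) * d j \<le> (b - a) * d i" using 1 by (simp add: algebra_simps)
      then have "d j \<le> d i" using \<open>a < b\<close> by simp
      then show ?thesis using 2 by linarith
    qed
    then have "0 \<le> form_val F (g i) (\<lambda>x. g j x - g i x)" using i ab by simp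
    then have "form_val F (g i) (g i) \<le> form_val F (g j) (g i)"
      using F.diff_right[OF g g g, of i j i] F.sym[OF g g, of i j] by simp
    then show ?thesis by (simp add: F.quad_diff g)
  qed
  have mono: "incseq (\<lambda>n. form_val F (g n) (g n))"
  proof (rule incseq_SucI)
    fix n
    show "form_val F (g n) (g n) \<le> form_val F (g (Suc n)) (g (Suc n))"
      using incr[of n "Suc n"] F.nonneg[OF F.diff_mem[OF g g], of "Suc n" n] by simp
  qed
  have conv: "convergent (\<lambda>n. form_val F (g n) (g n))"
    using incseq_convergent[OF mono, of C] Fle unfolding convergent_def by metis
  have "\<exists>N. \<forall>i\<ge>N. \<forall>j\<ge>N.
      shift_val M 1 F (\<lambda>x. g i x - g j x) (\<lambda>x. g i x - g j x) < e" if "0 < e" for e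
  proof -
    have "\<exists>N. \<forall>i\<ge>N. \<forall>j\<ge>N.
        dist (form_val F (g i) (g i)) (form_val F (g j) (g j)) < e / 2"
      by (rule metric_CauchyD[OF convergent_Cauchy[OF conv]]) (simp add: that)
    then obtain N1 where N1: "\<And>i j. N1 \<le> i \<Longrightarrow> N1 \<le> j \<Longrightarrow>
        dist (form_val F (g i) (g i)) (form_val F (g j) (g j)) < e / 2"
      by blast
    have "\<forall>\<^sub>F n in sequentially. d n < e / 8"
      by (rule order_tendstoD(2)[OF d_lim]) (simp add: that)
    then obtain N2 where N2: "\<And>n. N2 \<le> n \<Longrightarrow> d n < e / 8"
      unfolding eventually_sequentially by blast
    have "shift_val M 1 F (\<lambda>x. g i x - g j x) (\<lambda>x. g i x - g j x) < e"
      if ij: "max N1 N2 \<le> i" "max N1 N2 \<le> j" for i j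
    proof -
      have swap: "form_val F (\<lambda>x. g i x - g j x) (\<lambda>x. g i x - g j x)
          = form_val F (\<lambda>x. g j x - g i x) (\<lambda>x. g j x - g i x)"
        using F.sym[OF g g, of i j] by (simp add: F.quad_diff g)
      have "form_val F (\<lambda>x. g i x - g j x) (\<lambda>x. g i x - g j x) < e / 2"
      proof -
        have "\<bar>form_val F (g i) (g i) - form_val F (g j) (g j)\<bar> < e / 2"
          using N1[of i j] ij by (simp add: dist_real_def)
        then have "form_val F (g j) (g j) - form_val F (g i) (g i) < e / 2"
          "form_val F (g i) (g i) - form_val F (g j) (g j) < e / 2"
          unfolding abs_less_iff by argo+
        then show ?thesis
          using incr[of i j] incr[of j i] swap by (cases "i \<le> j") auto
      qed
      moreover have "l2_inner M (\<lambda>x. g i x - g j x) (\<lambda>x. g i x - g j x) < e / 2"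
      proof -
        have "(\<lambda>x. g i x - g j x) = (\<lambda>x. r j x - r i x)" by (simp add: r_def)
        then have "l2_inner M (\<lambda>x. g i x - g j x) (\<lambda>x. g i x - g j x) \<le> 2 * d i + 2 * d j"
          using L2.nonneg[OF L2.add_mem[OF r r], of i j] L2.sym[OF r r, of i j]
          by (simp add: L2.quad_diff L2.quad_add r d_def)
        then show ?thesis using N2[of i] N2[of j] ij by simp
      qed
      ultimately show ?thesis by (simp add: shift_val_def)
    qed
    then show ?thesis by blast
  qed
  then obtain w where w: "w \<in> form_dom F"
    and lim: "(\<lambda>n. shift_val M 1 F (\<lambda>x. g n x - w x) (\<lambda>x. g n x - w x)) \<longlonglongrightarrow> 0"
    using F g unfolding closed_form_def by blast
  note gw = F.diff_mem[OF g w]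
  have "(\<lambda>n. l2_inner M (\<lambda>x. g n x - w x) (\<lambda>x. g n x - w x)) \<longlonglongrightarrow> 0"
    by (rule Lim_null_comparison[OF _ lim])
      (use F.nonneg[OF gw] L2.nonneg[OF D[OF gw]] in \<open>simp add: shift_val_def\<close>)
  then have "(\<lambda>n. 2 * d n + 2 * l2_inner M (\<lambda>x. g n x - w x) (\<lambda>x. g n x - w x)) \<longlonglongrightarrow> 2 * 0 + 2 * 0"
    by (intro tendsto_intros d_lim)
  moreover have "l2_inner M (\<lambda>x. u x - w x) (\<lambda>x. u x - w x)
      \<le> 2 * d n + 2 * l2_inner M (\<lambda>x. g n x - w x) (\<lambda>x. g n x - w x)" for n
  proof -
    have "(\<lambda>x. u x - w x) = (\<lambda>x. r n x + (g n x - w x))" by (simp add: r_def)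
    then show ?thesis
      using L2.nonneg[OF L2.diff_mem[OF r D[OF gw]], of n n]
      by (simp add: L2.quad_diff[OF r D[OF gw]] L2.quad_add[OF r D[OF gw]] d_def)
  qed
  ultimately have "l2_inner M (\<lambda>x. u x - w x) (\<lambda>x. u x - w x) \<le> 0"
    by (intro LIMSEQ_le_const) auto
  then have "l2_inner M (\<lambda>x. u x - w x) (\<lambda>x. u x - w x) = 0"
    using L2.nonneg[OF L2.diff_mem[OF u D[OF w]]] by simp
  then have ae: "AE x in M. u x = w x"
    using l2_inner_self_eq_0_iff[OF L2.diff_mem[OF u D[OF w]]] by simp
  then have ae': "AE x in M. w x = u x" by eventually_elim simp
  show um: "u \<in> form_dom F" by (rule form_dom_saturated[OF ps w u ae'])
  have "(\<lambda>n. form_val F (\<lambda>x. g n x - w x) (\<lambda>x. g n x - w x)) \<longlonglongrightarrow> 0"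
    by (rule Lim_null_comparison[OF _ lim])
      (use F.nonneg[OF gw] L2.nonneg[OF D[OF gw]] in \<open>simp add: shift_val_def\<close>)
  then have "(\<lambda>n. form_val F (g n) (g n)) \<longlonglongrightarrow> form_val F w w"
    by (rule F.tendsto_form_sequence(2)[of g, OF g w])
  then have "form_val F w w \<le> C" using Fle by (intro LIMSEQ_le_const2) auto
  moreover have "form_val F u u = form_val F w w"
    using form_val_cong_AE[OF ps um w um ae] form_val_cong_AE[OF ps um w w ae] F.sym[OF um w]
    by simp
  ultimately show "form_val F u u \<le> C" by simp
qed


section \<open>Strong resolvent limits of Markovian forms\<close>

lemma closed_form_resolvent_exists:
  assumes F: "closed_form M F" and f: "f \<in> L2 M"
  shows "\<exists>u. (u, \<lambda>x. f x - u x) \<in> form_operator M F"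
proof -
  have ps: "positive_symmetric_form M F" using F by (simp add: closed_form_def)
  obtain g where "g \<in> form_dom F"
    "\<And>v. v \<in> form_dom F \<Longrightarrow> form_val F g v = 1 * l2_inner M (\<lambda>x. f x - g x) v"
    by (rule yosida_approximant[OF F zero_less_one f]) blast
  from yosida_in_form_operator[OF ps f this] show ?thesis by auto
qed

lemma resolvent1_mem:
  "\<exists>u. (u, \<lambda>x. f x - u x) \<in> H \<Longrightarrow> (resolvent1 H f, \<lambda>x. f x - resolvent1 H f x) \<in> H"
  unfolding resolvent1_def by (rule someI_ex[of "\<lambda>u. (u, \<lambda>x. f x - u x) \<in> H"])

lemma form_operator_resolvent_unique:
  assumes "psd_form (form_dom E) (form_val E)" and dom: "form_dom E \<subseteq> L2 M"
    and u: "(u, \<lambda>x. f x - u x) \<in> form_operator M E"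
    and v: "(v, \<lambda>x. f x - v x) \<in> form_operator M E"
  shows "l2_norm M (\<lambda>x. u x - v x) = 0"
proof -
  interpret psd_form "form_dom E" "form_val E" by fact
  have m: "u \<in> form_dom E" "v \<in> form_dom E" "(\<lambda>x. f x - u x) \<in> L2 M" "(\<lambda>x. f x - v x) \<in> L2 M"
    using u v by (auto simp: form_operator_def)
  let ?d = "\<lambda>x. u x - v x"
  have d: "?d \<in> form_dom E" by (intro diff_mem m)
  have dL: "?d \<in> L2 M" using d dom by blast
  have "form_val E ?d ?d = l2_inner M (\<lambda>x. f x - u x) ?d - l2_inner M (\<lambda>x. f x - v x) ?d"
    using diff_left[OF m(1,2) d] u v d by (simp add: form_operator_def)
  also have "\<dots> = l2_inner M (\<lambda>x. (f x - u x) - (f x - v x)) ?d"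
    using L2.diff_left[OF m(3,4) dL] by simp
  also have "\<dots> = l2_inner M (\<lambda>x. -1 * ?d x) ?d" by (simp add: algebra_simps)
  also have "\<dots> = - l2_inner M ?d ?d" using L2.scale_left[OF dL dL, of "-1"] by simp
  finally have "l2_inner M ?d ?d = 0"
    using nonneg[OF d] L2.nonneg[OF dL] by linarith
  then show ?thesis by (simp add: l2_norm_def)
qed

text \<open>
  On the forms \<open>E t\<close> the contraction property is rewritten, by \<open>dual_bound\<close> and the definition of
  the operator, as an inequality between \<open>L\<^sup>2\<close> inner products of resolvents and their cut-offs.  It passes to the limit,
  and \<open>form_le_of_dual_bound\<close> translates it back into a statement on \<open>F\<close>.
\<close>

lemma markovian_of_strong_resolvent_limit:
  assumes F: "closed_form M F" and "\<T> \<noteq> bot"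
    and psd: "\<forall>\<^sub>F t in \<T>. psd_form (form_dom (E t)) (form_val (E t)) \<and> form_dom (E t) \<subseteq> L2 M"
    and ex: "\<forall>\<^sub>F t in \<T>. \<forall>f\<in>L2 M. \<exists>u. (u, \<lambda>x. f x - u x) \<in> form_operator M (E t)"
    and markov: "\<forall>\<^sub>F t in \<T>. \<forall>u\<in>form_dom (E t). unit_contraction u \<in> form_dom (E t) \<and>
        form_val (E t) (unit_contraction u) (unit_contraction u) \<le> form_val (E t) u u"
    and conv: "\<And>f. f \<in> L2 M \<Longrightarrow>
        ((\<lambda>t. l2_norm M (\<lambda>x. resolvent1 (form_operator M (E t)) f x
          - resolvent1 (form_operator M F) f x)) \<longlongrightarrow> 0) \<T>"
    and u: "u \<in> form_dom F"
  shows "unit_contraction u \<in> form_dom F"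
    and "form_val F (unit_contraction u) (unit_contraction u) \<le> form_val F u u"
proof -
  have ps: "positive_symmetric_form M F" using F by (simp add: closed_form_def)
  interpret F: psd_form "form_dom F" "form_val F" by (rule positive_symmetric_psd[OF ps])
  note D = form_dom_L2[OF ps]
  define R where "R t f = resolvent1 (form_operator M (E t)) f" for t f
  have R: "\<forall>\<^sub>F t in \<T>. \<forall>f\<in>L2 M. (R t f, \<lambda>x. f x - R t f x) \<in> form_operator M (E t)"
    using ex by eventually_elim (auto simp: R_def intro: resolvent1_mem)
  have RL: "\<forall>\<^sub>F t in \<T>. R t f \<in> L2 M" if "f \<in> L2 M" for f
    using R psd by eventually_elim (use that in \<open>auto simp: form_operator_def\<close>)
  \<comment> \<open>Every \<open>g\<close> in the operator domain is the resolvent of \<open>g + H g\<close>.\<close>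
  have R_lim: "((\<lambda>t. l2_norm M (\<lambda>x. R t (\<lambda>x. g x + k x) x - g x)) \<longlongrightarrow> 0) \<T>"
    if gk: "(g, k) \<in> form_operator M F" for g k
  proof (rule Lim_null_comparison)
    let ?f = "\<lambda>x. g x + k x" and ?r = "resolvent1 (form_operator M F) (\<lambda>x. g x + k x)"
    have g: "g \<in> L2 M" and k: "k \<in> L2 M" using gk D by (auto simp: form_operator_def)
    have f: "?f \<in> L2 M" by (intro L2.add_mem g k)
    have r: "(?r, \<lambda>x. ?f x - ?r x) \<in> form_operator M F"
      by (intro resolvent1_mem closed_form_resolvent_exists[OF F f])
    have rL: "?r \<in> L2 M" using r D by (auto simp: form_operator_def)
    have "(g, \<lambda>x. ?f x - g x) \<in> form_operator M F" using gk by simp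
    with r have z: "l2_norm M (\<lambda>x. ?r x - g x) = 0"
      by (intro form_operator_resolvent_unique[where f = ?f and E = F] F.psd_form_axioms)
        (auto simp: D)
    show "((\<lambda>t. l2_norm M (\<lambda>x. R t ?f x - ?r x)) \<longlongrightarrow> 0) \<T>"
      unfolding R_def by (rule conv[OF f])
    show "\<forall>\<^sub>F t in \<T>. norm (l2_norm M (\<lambda>x. R t ?f x - g x)) \<le> l2_norm M (\<lambda>x. R t ?f x - ?r x)"
      using RL[OF f]
    proof eventually_elim
      case (elim t)
      show ?case
        using L2.nrm_triangle[OF elim rL g] L2.nrm_nonneg[OF L2.diff_mem[OF elim g]] z by simp
    qed
  qed
  \<comment> \<open>On the operator domain the contraction passes to the limit inside the dual description of
    the form, which involves only \<open>L\<^sup>2\<close> inner products of resolvents.\<close>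
  have on_operator_domain: "unit_contraction u \<in> form_dom F \<and>
      form_val F (unit_contraction u) (unit_contraction u) \<le> form_val F u u"
    if uh: "(u, h) \<in> form_operator M F" for u h
  proof -
    have um: "u \<in> form_dom F" and h: "h \<in> L2 M" using uh by (auto simp: form_operator_def)
    note uL = D[OF um]
    have Tu: "unit_contraction u \<in> L2 M" by (rule unit_contraction_L2[OF uL])
    have "2 * l2_inner M k (unit_contraction u) - form_val F g g \<le> form_val F u u"
      if gk: "(g, k) \<in> form_operator M F" for g k
    proof -
      have gm: "g \<in> form_dom F" and k: "k \<in> L2 M" using gk by (auto simp: form_operator_def)
      note gL = D[OF gm]
      define p where "p t = R t (\<lambda>x. u x + h x)" for t
      define q where "q t = R t (\<lambda>x. g x + k x)" for t
      have pL: "\<forall>\<^sub>F t in \<T>. p t \<in> L2 M" and qL: "\<forall>\<^sub>F t in \<T>. q t \<in> L2 M"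
        unfolding p_def q_def by (intro RL L2.add_mem uL h gL k)+
      have p: "((\<lambda>t. l2_norm M (\<lambda>x. p t x - u x)) \<longlongrightarrow> 0) \<T>"
        and q: "((\<lambda>t. l2_norm M (\<lambda>x. q t x - g x)) \<longlongrightarrow> 0) \<T>"
        unfolding p_def q_def by (intro R_lim uh gk)+
      have Tp: "((\<lambda>t. l2_norm M (\<lambda>x. unit_contraction (p t) x - unit_contraction u x)) \<longlongrightarrow> 0) \<T>"
        by (rule unit_contraction_tendsto[OF pL uL p])
      have TpL: "\<forall>\<^sub>F t in \<T>. unit_contraction (p t) \<in> L2 M"
        using pL by eventually_elim (rule unit_contraction_L2)
      have rest: "((\<lambda>t. l2_norm M (\<lambda>x. (a x + b x - w t x) - b x)) \<longlongrightarrow> 0) \<T>"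
        if a: "a \<in> L2 M" and w: "\<forall>\<^sub>F t in \<T>. w t \<in> L2 M"
          and lim: "((\<lambda>t. l2_norm M (\<lambda>x. w t x - a x)) \<longlongrightarrow> 0) \<T>" for a b w
      proof (rule Lim_transform_eventually[OF lim])
        show "\<forall>\<^sub>F t in \<T>. l2_norm M (\<lambda>x. w t x - a x)
            = l2_norm M (\<lambda>x. (a x + b x - w t x) - b x)"
          using w
        proof eventually_elim
          case (elim t)
          show ?case using L2.nrm_diff_commute[OF elim a] by (simp add: algebra_simps)
        qed
      qed
      have restL: "\<forall>\<^sub>F t in \<T>. (\<lambda>x. a x + b x - w t x) \<in> L2 M"
        if "a \<in> L2 M" "b \<in> L2 M" "\<forall>\<^sub>F t in \<T>. w t \<in> L2 M" for a b w
        using that(3) by eventually_elim (intro L2.diff_mem L2.add_mem that(1,2))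
      have 1: "((\<lambda>t. 2 * l2_inner M (\<lambda>x. g x + k x - q t x) (unit_contraction (p t))
            - l2_inner M (\<lambda>x. g x + k x - q t x) (q t))
          \<longlongrightarrow> 2 * l2_inner M k (unit_contraction u) - l2_inner M k g) \<T>"
        by (intro tendsto_intros L2.tendsto_form restL rest pL qL p q TpL Tp Tu gL k)
      have 2: "((\<lambda>t. l2_inner M (\<lambda>x. u x + h x - p t x) (p t)) \<longlongrightarrow> l2_inner M h u) \<T>"
        by (intro L2.tendsto_form restL rest pL p uL h)
      have le: "\<forall>\<^sub>F t in \<T>. 2 * l2_inner M (\<lambda>x. g x + k x - q t x) (unit_contraction (p t))
            - l2_inner M (\<lambda>x. g x + k x - q t x) (q t) \<le> l2_inner M (\<lambda>x. u x + h x - p t x) (p t)"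
        using psd R markov
      proof eventually_elim
        case (elim t)
        interpret E: psd_form "form_dom (E t)" "form_val (E t)" using elim(1) by simp
        have p: "(p t, \<lambda>x. u x + h x - p t x) \<in> form_operator M (E t)"
          unfolding p_def by (rule elim(2)[rule_format, OF L2.add_mem[OF uL h]])
        have q: "(q t, \<lambda>x. g x + k x - q t x) \<in> form_operator M (E t)"
          unfolding q_def by (rule elim(2)[rule_format, OF L2.add_mem[OF gL k]])
        have pm: "p t \<in> form_dom (E t)" and qm: "q t \<in> form_dom (E t)"
          using p q by (auto simp: form_operator_def)
        have Tpm: "unit_contraction (p t) \<in> form_dom (E t)" using elim(3) pm by blast
        have "2 * l2_inner M (\<lambda>x. g x + k x - q t x) (unit_contraction (p t))
            - l2_inner M (\<lambda>x. g x + k x - q t x) (q t)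
            = 2 * form_val (E t) (q t) (unit_contraction (p t)) - form_val (E t) (q t) (q t)"
          using q qm Tpm by (simp add: form_operator_def)
        also have "\<dots> \<le> form_val (E t) (unit_contraction (p t)) (unit_contraction (p t))"
          by (rule E.dual_bound[OF qm Tpm])
        also have "\<dots> \<le> form_val (E t) (p t) (p t)" using elim(3) pm by blast
        also have "\<dots> = l2_inner M (\<lambda>x. u x + h x - p t x) (p t)"
          using p pm by (simp add: form_operator_def)
        finally show ?case .
      qed
      have "2 * l2_inner M k (unit_contraction u) - l2_inner M k g \<le> l2_inner M h u"
        by (rule tendsto_le[OF \<open>\<T> \<noteq> bot\<close> 2 1 le])
      then show ?thesis using uh gk um gm by (simp add: form_operator_def)
    qed
    from form_le_of_dual_bound[OF F Tu this] show ?thesis by blast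
  qed
  \<comment> \<open>A general \<open>u\<close> is approximated in \<open>L\<^sup>2\<close> by elements \<open>w n\<close> of the operator domain with
    \<open>F[w n] \<le> F[u]\<close>.\<close>
  note uL = D[OF u]
  have Tu: "unit_contraction u \<in> L2 M" by (rule unit_contraction_L2[OF uL])
  have "2 * l2_inner M k u - form_val F g g \<le> form_val F u u" if "(g, k) \<in> form_operator M F" for g k
    using F.dual_bound[of g u] that u by (simp add: form_operator_def)
  from yosida_sequence[OF F uL this] obtain w where w: "\<And>n. w n \<in> form_dom F" and
    eq: "\<And>n v. v \<in> form_dom F \<Longrightarrow>
      form_val F (w n) v = real (Suc n) * l2_inner M (\<lambda>x. u x - w n x) v" and
    le: "\<And>n. form_val F (w n) (w n) \<le> form_val F u u" and
    lim: "(\<lambda>n. l2_inner M (\<lambda>x. u x - w n x) (\<lambda>x. u x - w n x)) \<longlonglongrightarrow> 0"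
    by blast
  have Tw: "unit_contraction (w n) \<in> form_dom F \<and>
      form_val F (unit_contraction (w n)) (unit_contraction (w n)) \<le> form_val F (w n) (w n)" for n
    by (rule on_operator_domain[OF yosida_in_form_operator[OF ps uL w eq]])
  have "(\<lambda>n. l2_norm M (\<lambda>x. u x - w n x)) \<longlonglongrightarrow> 0"
    using tendsto_real_sqrt[OF lim] by (simp add: l2_norm_def)
  then have "(\<lambda>n. l2_norm M (\<lambda>x. w n x - u x)) \<longlonglongrightarrow> 0"
    by (simp add: L2.nrm_diff_commute[OF uL D[OF w]])
  then have Tlim: "(\<lambda>n. l2_norm M (\<lambda>x. unit_contraction (w n) x - unit_contraction u x)) \<longlonglongrightarrow> 0"
    by (rule unit_contraction_tendsto[of w, rotated 2]) (auto simp: D w uL)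
  have "2 * l2_inner M k (unit_contraction u) - form_val F g g \<le> form_val F u u"
    if gk: "(g, k) \<in> form_operator M F" for g k
  proof -
    have gm: "g \<in> form_dom F" and k: "k \<in> L2 M" using gk by (auto simp: form_operator_def)
    have z: "l2_norm M (\<lambda>x. 0) = 0" by (simp add: l2_norm_def l2_inner_def)
    have "(\<lambda>n. 2 * l2_inner M k (unit_contraction (w n)) - form_val F g g)
        \<longlonglongrightarrow> 2 * l2_inner M k (unit_contraction u) - form_val F g g"
      by (intro tendsto_intros L2.tendsto_form Tlim) (auto simp: k z Tu D Tw)
    moreover have "2 * l2_inner M k (unit_contraction (w n)) - form_val F g g \<le> form_val F u u" for n
      using F.dual_bound[OF gm, of "unit_contraction (w n)"] gk Tw[of n] le[of n]
      by (auto simp: form_operator_def)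
    ultimately show ?thesis by (intro LIMSEQ_le_const2) auto
  qed
  from form_le_of_dual_bound[OF F Tu this]
  show "unit_contraction u \<in> form_dom F"
    and "form_val F (unit_contraction u) (unit_contraction u) \<le> form_val F u u" by blast+
qed


section \<open>Quasi-continuous functions\<close>

locale borel_dirichlet_form =
  fixes m :: "'a::topological_space measure" and E :: "'a l2_form"
  assumes dirichlet: "dirichlet_form m E" and sets_eq: "sets m = sets borel"
begin

lemma closed: "closed_form m E"
  using dirichlet by (simp add: dirichlet_form_def)

lemma positive_symmetric: "positive_symmetric_form m E"
  using closed by (simp add: closed_form_def)

lemmas dom_L2 = form_dom_L2[OF positive_symmetric]

sublocale E1: psd_form "form_dom E" "shift_val m 1 E"
  by (rule shift_psd[OF positive_symmetric zero_le_one])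

lemma l2_inner_le_shift:
  "u \<in> form_dom E \<Longrightarrow> l2_inner m u u \<le> shift_val m 1 E u u"
  using psd_form.nonneg[OF positive_symmetric_psd[OF positive_symmetric]]
  by (simp add: shift_val_def)

lemma contraction_dom: "u \<in> form_dom E \<Longrightarrow> unit_contraction u \<in> form_dom E"
  using dirichlet by (simp add: dirichlet_form_def)

lemma contraction_shift_le:
  assumes u: "u \<in> form_dom E" and "0 \<le> \<alpha>"
  shows "shift_val m \<alpha> E (unit_contraction u) (unit_contraction u) \<le> shift_val m \<alpha> E u u"
  using dirichlet u mult_left_mono[OF unit_contraction_L2(2)[OF dom_L2[OF u]] \<open>0 \<le> \<alpha>\<close>]
  by (fastforce simp: dirichlet_form_def shift_val_def intro: add_mono)

lemma contraction_nrm_le: "u \<in> form_dom E \<Longrightarrow> E1.nrm (unit_contraction u) \<le> E1.nrm u"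
  using contraction_shift_le[of u 1] by (simp add: E1.nrm_def)

text \<open>
  A bound on the capacity expressed by a test function and by norms instead of energies: norms are
  subadditive, so that unions need only sums of test functions and no maxima.  The price is
  that the square root of the capacity, and not the capacity, is estimated; the nonnegativity makes
  the sum a test function for the union.
\<close>

definition small :: "real \<Rightarrow> 'a set \<Rightarrow> bool" where
  "small s U \<longleftrightarrow> open U \<and>
     (\<exists>v\<in>form_dom E. (AE x in m. 0 \<le> v x) \<and> (AE x in m. x \<in> U \<longrightarrow> 1 \<le> v x) \<and> E1.nrm v \<le> s)"

lemma small_mono: "small s U \<Longrightarrow> s \<le> t \<Longrightarrow> small t U"
  unfolding small_def by (meson order_trans)

text \<open>
  Cutting off an almost optimal test function makes it nonnegative without increasing its energy.
\<close>

lemma small_of_capacity: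
  assumes cap: "capacity m E A < ennreal (s\<^sup>2)" and "0 \<le> s"
  shows "\<exists>U. A \<subseteq> U \<and> small s U"
proof -
  obtain U where U: "open U" "A \<subseteq> U" and "capacity_open m E U < ennreal (s\<^sup>2)"
    using cap unfolding capacity_def by (auto simp: INF_less_iff)
  then obtain u where u: "u \<in> form_dom E" "AE x in m. x \<in> U \<longrightarrow> 1 \<le> u x"
    and "ennreal (shift_val m 1 E u u) < ennreal (s\<^sup>2)"
    unfolding capacity_open_def by (auto simp: INF_less_iff)
  then have "E1.nrm u \<le> s"
    using \<open>0 \<le> s\<close> by (simp add: E1.nrm_le_iff ennreal_less_iff E1.nonneg)
  then have "E1.nrm (unit_contraction u) \<le> s" using contraction_nrm_le[OF u(1)] by linarith
  moreover have "AE x in m. x \<in> U \<longrightarrow> 1 \<le> unit_contraction u x"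
    using u(2) by eventually_elim (simp add: unit_contraction_eq_1)
  ultimately have "small s U"
    using U contraction_dom[OF u(1)] unit_contraction_range(1)[of u] by (auto simp: small_def)
  then show ?thesis using U by blast
qed

lemma capacity_le_of_small:
  assumes "small s U" "0 \<le> s" "A \<subseteq> U"
  shows "capacity m E A \<le> ennreal (s\<^sup>2)"
proof -
  obtain v where v: "open U" "v \<in> form_dom E" "AE x in m. x \<in> U \<longrightarrow> 1 \<le> v x" "E1.nrm v \<le> s"
    using assms(1) by (auto simp: small_def)
  have "capacity m E A \<le> capacity_open m E U"
    unfolding capacity_def using v(1) assms(3) by (intro INF_lower) auto
  also have "\<dots> \<le> ennreal (shift_val m 1 E v v)"
    unfolding capacity_open_def using v by (intro INF_lower) auto
  also have "\<dots> \<le> ennreal (s\<^sup>2)"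
    using v(2,4) \<open>0 \<le> s\<close> by (intro ennreal_leI) (simp add: E1.nrm_le_iff)
  finally show ?thesis .
qed

lemma small_Un:
  assumes "small s U" "small t V"
  shows "small (s + t) (U \<union> V)"
proof -
  obtain u where u: "u \<in> form_dom E" "AE x in m. 0 \<le> u x" "AE x in m. x \<in> U \<longrightarrow> 1 \<le> u x"
    "E1.nrm u \<le> s" using assms(1) by (auto simp: small_def)
  obtain v where v: "v \<in> form_dom E" "AE x in m. 0 \<le> v x" "AE x in m. x \<in> V \<longrightarrow> 1 \<le> v x"
    "E1.nrm v \<le> t" using assms(2) by (auto simp: small_def)
  have "AE x in m. 0 \<le> u x + v x" using u(2) v(2) by eventually_elim simp
  moreover have "AE x in m. x \<in> U \<union> V \<longrightarrow> 1 \<le> u x + v x"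
    using u(2,3) v(2,3) by eventually_elim auto
  moreover have "E1.nrm (\<lambda>x. u x + v x) \<le> s + t"
    using E1.nrm_add[OF u(1) v(1)] u(4) v(4) by linarith
  moreover have "open (U \<union> V)" using assms by (simp add: small_def open_Un)
  ultimately show ?thesis
    using E1.add_mem[OF u(1) v(1)] unfolding small_def by (intro conjI bexI[of _ "\<lambda>x. u x + v x"])
qed

text \<open>
  The series of the test functions converges in the form norm, and its sum dominates each of them.
\<close>

lemma small_UN:
  assumes small: "\<And>n. small (C / 2 ^ n) (U n)"
  shows "small (2 * C) (\<Union>n. U n)"
proof -
  have "\<exists>v. v \<in> form_dom E \<and> (AE x in m. 0 \<le> v x) \<and> (AE x in m. x \<in> U n \<longrightarrow> 1 \<le> v x)
      \<and> E1.nrm v \<le> C / 2 ^ n" for n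
    using small[of n] unfolding small_def by blast
  then have "\<exists>v. \<forall>n. v n \<in> form_dom E \<and> (AE x in m. 0 \<le> v n x) \<and>
      (AE x in m. x \<in> U n \<longrightarrow> 1 \<le> v n x) \<and> E1.nrm (v n) \<le> C / 2 ^ n"
    by (intro choice allI)
  then obtain v where v: "\<And>n. v n \<in> form_dom E" and v0: "\<And>n. AE x in m. 0 \<le> v n x"
    and v1: "\<And>n. AE x in m. x \<in> U n \<longrightarrow> 1 \<le> v n x" and vC: "\<And>n. E1.nrm (v n) \<le> C / 2 ^ n"
    by blast
  have C: "0 \<le> C" using vC[of 0] E1.nrm_nonneg[OF v, of 0] by simp
  define w where "w n = (\<lambda>x. \<Sum>k<n. v k x)" for n
  have w0: "w 0 = (\<lambda>x. 0)" and wS: "w (Suc n) = (\<lambda>x. w n x + v n x)" for n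
    by (auto simp: w_def)
  have w: "w n \<in> form_dom E" for n
    by (induction n) (auto simp: w0 wS E1.zero_mem intro: E1.add_mem v)
  have diff: "(\<lambda>x. w (Suc n) x - w n x) = v n" for n by (simp add: wS)
  have sum_C: "summable (\<lambda>n. C / 2 ^ n)"
    using summable_mult[OF summable_geometric[of "1/2::real"], of C] by (simp add: power_divide)
  have "summable (\<lambda>n. E1.nrm (v n))"
    by (rule summable_comparison_test'[OF sum_C, of 0]) (use vC v in simp)
  then have "summable (\<lambda>n. E1.nrm (\<lambda>x. w (Suc n) x - w n x))" by (simp only: diff)
  from closed_form_summable_limit[of m E w, OF closed w this]
  obtain w' where w': "w' \<in> form_dom E"
    and lim: "(\<lambda>n. shift_val m 1 E (\<lambda>x. w n x - w' x) (\<lambda>x. w n x - w' x)) \<longlonglongrightarrow> 0" by blast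
  have "E1.nrm (w n) \<le> 2 * C" for n
  proof -
    have "E1.nrm (w n) \<le> 2 * C - 2 * C / 2 ^ n"
    proof (induction n)
      case 0
      then show ?case by (simp add: w0 E1.nrm_def E1.zero_left[OF E1.zero_mem])
    next
      case (Suc n)
      then show ?case
        using E1.nrm_add[OF w v, of n n] vC[of n] by (simp add: wS)
    qed
    moreover have "0 \<le> 2 * C / 2 ^ n" using C by simp
    ultimately show ?thesis by linarith
  qed
  then have "shift_val m 1 E (w n) (w n) \<le> (2 * C)\<^sup>2" for n
    using C E1.nrm_le_iff[OF _ w, of "2 * C" n] by simp
  then have "shift_val m 1 E w' w' \<le> (2 * C)\<^sup>2"
    by (intro LIMSEQ_le_const2[OF E1.tendsto_form_sequence(2)[of w, OF w w' lim]]) auto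
  then have w'C: "E1.nrm w' \<le> 2 * C" using E1.nrm_le_iff[OF _ w', of "2 * C"] C by simp
  have liml2: "(\<lambda>n. l2_inner m (\<lambda>x. w n x - w' x) (\<lambda>x. w n x - w' x)) \<longlonglongrightarrow> 0"
    by (rule Lim_null_comparison[OF _ lim])
      (simp add: l2_inner_le_shift E1.diff_mem w w' L2.nonneg dom_L2)
  have all0: "AE x in m. \<forall>n. 0 \<le> v n x" using v0 by (simp add: AE_all_countable)
  have ge: "AE x in m. v k x \<le> w' x" for k
  proof (rule AE_le_L2_limit[of w, OF _ _ _ liml2])
    show "\<forall>\<^sub>F n in sequentially. AE x in m. v k x \<le> w n x"
      using eventually_gt_at_top[of k]
    proof eventually_elim
      case (elim n)
      show ?case using all0
        by eventually_elim (use elim in \<open>auto simp: w_def intro: member_le_sum\<close>)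
    qed
  qed (auto intro: dom_L2 w w' v)
  have "AE x in m. 0 \<le> w' x" using ge[of 0] v0[of 0] by eventually_elim simp
  moreover have "AE x in m. x \<in> (\<Union>n. U n) \<longrightarrow> 1 \<le> w' x"
  proof -
    have "AE x in m. \<forall>n. x \<in> U n \<longrightarrow> 1 \<le> v n x" "AE x in m. \<forall>n. v n x \<le> w' x"
      using v1 ge by (simp_all add: AE_all_countable)
    then show ?thesis by eventually_elim (blast intro: order_trans)
  qed
  moreover have "open (\<Union>n. U n)" using small unfolding small_def by blast
  ultimately show ?thesis using w' w'C unfolding small_def by (intro conjI bexI[of _ w'])
qed

lemma quasi_continuous_iff_small:
  "quasi_continuous m E u \<longleftrightarrow> (\<forall>s>0. \<exists>U. small s U \<and> continuous_on (- U) u)"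
proof
  assume qc: "quasi_continuous m E u"
  show "\<forall>s>0. \<exists>U. small s U \<and> continuous_on (- U) u"
  proof (intro allI impI)
    fix s :: real assume "0 < s"
    then obtain U where U: "capacity m E U < ennreal (s\<^sup>2)" "continuous_on (- U) u"
      using qc unfolding quasi_continuous_def by (meson zero_less_power)
    then obtain V where "U \<subseteq> V" "small s V"
      using small_of_capacity[OF U(1)] \<open>0 < s\<close> by auto
    then show "\<exists>U. small s U \<and> continuous_on (- U) u"
      using U(2) by (meson Compl_anti_mono continuous_on_subset)
  qed
next
  assume sm: "\<forall>s>0. \<exists>U. small s U \<and> continuous_on (- U) u"
  show "quasi_continuous m E u"
    unfolding quasi_continuous_def
  proof (intro allI impI)
    fix e :: real assume "0 < e"
    then obtain U where U: "small (sqrt e / 2) U" "continuous_on (- U) u"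
      using sm by (meson half_gt_zero real_sqrt_gt_zero)
    have "capacity m E U \<le> ennreal ((sqrt e / 2)\<^sup>2)"
      using \<open>0 < e\<close> by (intro capacity_le_of_small[OF U(1)]) auto
    also have "\<dots> < ennreal e"
      using \<open>0 < e\<close> by (simp add: power_divide ennreal_less_iff)
    finally show "\<exists>U. open U \<and> capacity m E U < ennreal e \<and> continuous_on (- U) u"
      using U by (auto simp: small_def)
  qed
qed

lemma qc_dom_obtain_small:
  assumes "u \<in> qc_dom m E" "0 < s"
  obtains U where "small s U" "continuous_on (- U) u"
  using assms by (auto simp: qc_dom_def quasi_continuous_iff_small)

lemma qc_dom_D: "u \<in> qc_dom m E \<Longrightarrow> u \<in> form_dom E"
  by (simp add: qc_dom_def)

lemma small_empty: "0 \<le> s \<Longrightarrow> small s {}"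
  unfolding small_def
  by (auto intro!: bexI[of _ "\<lambda>x. 0"] simp: E1.zero_mem E1.nrm_def E1.zero_left)

lemma qc_dom_zero: "(\<lambda>x. 0) \<in> qc_dom m E"
  by (auto simp: qc_dom_def quasi_continuous_iff_small E1.zero_mem
      intro!: exI[of _ "{}"] small_empty)

lemma qc_dom_scale:
  assumes u: "u \<in> qc_dom m E"
  shows "(\<lambda>x. c * u x) \<in> qc_dom m E"
proof -
  have "\<exists>U. small s U \<and> continuous_on (- U) (\<lambda>x. c * u x)" if "0 < s" for s
    using qc_dom_obtain_small[OF u that] by (metis continuous_on_mult_left)
  then show ?thesis using u by (simp add: qc_dom_def quasi_continuous_iff_small E1.scale_mem)
qed

lemma qc_dom_contraction:
  assumes u: "u \<in> qc_dom m E"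
  shows "unit_contraction u \<in> qc_dom m E"
proof -
  have "\<exists>U. small s U \<and> continuous_on (- U) (unit_contraction u)" if s: "0 < s" for s
  proof -
    obtain U where "small s U" and c: "continuous_on (- U) u"
      by (rule qc_dom_obtain_small[OF u s])
    moreover have "continuous_on (- U) (unit_contraction u)"
      unfolding unit_contraction_def by (intro continuous_intros c)
    ultimately show ?thesis by blast
  qed
  then show ?thesis using u by (simp add: qc_dom_def quasi_continuous_iff_small contraction_dom)
qed

lemma qc_dom_add:
  assumes u: "u \<in> qc_dom m E" and v: "v \<in> qc_dom m E"
  shows "(\<lambda>x. u x + v x) \<in> qc_dom m E"
proof -
  have "\<exists>U. small s U \<and> continuous_on (- U) (\<lambda>x. u x + v x)" if s: "0 < s" for s
  proof -
    obtain U where U: "small (s/2) U" "continuous_on (- U) u"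
      using qc_dom_obtain_small[OF u half_gt_zero[OF s]] .
    obtain V where V: "small (s/2) V" "continuous_on (- V) v"
      using qc_dom_obtain_small[OF v half_gt_zero[OF s]] .
    have "continuous_on (- (U \<union> V)) (\<lambda>x. u x + v x)"
      by (intro continuous_on_add continuous_on_subset[OF U(2)] continuous_on_subset[OF V(2)]) auto
    then show ?thesis using small_Un[OF U(1) V(1)] by auto
  qed
  then show ?thesis using u v by (simp add: qc_dom_def quasi_continuous_iff_small E1.add_mem)
qed

lemma qc_dom_diff: "u \<in> qc_dom m E \<Longrightarrow> v \<in> qc_dom m E \<Longrightarrow> (\<lambda>x. u x - v x) \<in> qc_dom m E"
  using qc_dom_add[OF _ qc_dom_scale[of v "-1"], of u] by simp

text \<open>
  Chebyshev's inequality for the capacity.  For a quasi-continuous \<open>u\<close> the superlevel set becomes open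
  after the addition of a small open set outside of which \<open>u\<close> is continuous.  The cut-offs of
  \<open>u / r\<close> and \<open>- u / r\<close> serve as test functions for the two signs of \<open>u\<close>.
\<close>

lemma small_superlevel:
  assumes u: "u \<in> qc_dom m E" and "0 < r" "0 < \<delta>"
  obtains A where "{x. r < \<bar>u x\<bar>} \<subseteq> A" "small (2 * E1.nrm u / r + \<delta>) A"
proof -
  obtain U where U: "small \<delta> U" "continuous_on (- U) u"
    by (rule qc_dom_obtain_small[OF u \<open>0 < \<delta>\<close>])
  obtain w where w: "w \<in> form_dom E" "AE x in m. 0 \<le> w x" "AE x in m. x \<in> U \<longrightarrow> 1 \<le> w x"
    "E1.nrm w \<le> \<delta>" using U by (auto simp: small_def)
  have ud: "u \<in> form_dom E" by (rule qc_dom_D[OF u])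
  define p where "p = unit_contraction (\<lambda>x. (1 / r) * u x)"
  define q where "q = unit_contraction (\<lambda>x. (- 1 / r) * u x)"
  have p: "p \<in> form_dom E" "E1.nrm p \<le> E1.nrm u / r"
    using contraction_nrm_le[OF E1.scale_mem[OF ud, of "1 / r"]] \<open>0 < r\<close>
    by (auto simp: p_def contraction_dom E1.scale_mem[OF ud, of "1 / r", simplified]
        E1.nrm_scale[OF ud, of "1 / r", simplified])
  have q: "q \<in> form_dom E" "E1.nrm q \<le> E1.nrm u / r"
    using contraction_nrm_le[OF E1.scale_mem[OF ud, of "- 1 / r"]] \<open>0 < r\<close>
      contraction_dom[OF E1.scale_mem[OF ud, of "- 1 / r"]] E1.nrm_scale[OF ud, of "- 1 / r"]
    by (auto simp: q_def)
  let ?v = "\<lambda>x. (p x + q x) + w x"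
  let ?A = "U \<union> {x. r < \<bar>u x\<bar>}"
  have "closed (- U)" using U by (auto simp: small_def)
  then have "closed (- U \<inter> u -` {- r..r})"
    using U(2) by (intro continuous_closed_preimage) auto
  moreover have "?A = - (- U \<inter> u -` {- r..r})" by auto
  ultimately have "open ?A" by (simp only: open_Compl)
  moreover have "AE x in m. 0 \<le> ?v x" using w(2)
    by eventually_elim (auto simp: p_def q_def unit_contraction_range intro!: add_nonneg_nonneg)
  moreover have "AE x in m. x \<in> ?A \<longrightarrow> 1 \<le> ?v x"
    using w(2,3)
  proof eventually_elim
    case (elim x)
    have nn: "0 \<le> p x" "0 \<le> q x" by (simp_all add: p_def q_def unit_contraction_range)
    have "p x = 1 \<or> q x = 1" if "r < \<bar>u x\<bar>"
    proof (cases "0 \<le> u x")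
      case True
      then show ?thesis using that \<open>0 < r\<close> by (simp add: p_def unit_contraction_eq_1)
    next
      case False
      then have "1 \<le> (- 1 / r) * u x" using that \<open>0 < r\<close> by (simp add: field_simps)
      then show ?thesis unfolding q_def by (simp add: unit_contraction_eq_1)
    qed
    then show ?case using elim nn by auto
  qed
  moreover have "E1.nrm ?v \<le> 2 * E1.nrm u / r + \<delta>"
    using E1.nrm_add[OF E1.add_mem[OF p(1) q(1)] w(1)] E1.nrm_add[OF p(1) q(1)] p(2) q(2) w(4)
    by simp
  moreover have "?v \<in> form_dom E" by (intro E1.add_mem p q w)
  ultimately have "small (2 * E1.nrm u / r + \<delta>) ?A"
    unfolding small_def by (intro conjI bexI[of _ ?v])
  then show thesis by (intro that[of ?A]) auto
qed

lemma polar_of_small: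
  assumes small: "\<And>k. small (C / 2 ^ k) (V k)" and sub: "\<And>k. Z \<subseteq> V k" and "0 \<le> C"
  shows "capacity m E Z = 0"
proof -
  have "capacity m E Z \<le> 0 + ennreal e" if "0 < e" for e
  proof -
    have "(\<lambda>k. (C * (1 / 2) ^ k)\<^sup>2) \<longlonglongrightarrow> (C * 0)\<^sup>2"
      by (intro tendsto_intros LIMSEQ_power_zero) simp
    then have "(\<lambda>k. (C / 2 ^ k)\<^sup>2) \<longlonglongrightarrow> 0" by (simp add: power_divide)
    from eventually_happens'[OF sequentially_bot order_tendstoD(2)[OF this that]]
    obtain k where k: "(C / 2 ^ k)\<^sup>2 < e" by blast
    have "capacity m E Z \<le> ennreal ((C / 2 ^ k)\<^sup>2)"
      using \<open>0 \<le> C\<close> by (intro capacity_le_of_small[OF small _ sub]) auto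
    also have "\<dots> \<le> ennreal e" using k by (intro ennreal_leI) simp
    finally show ?thesis by simp
  qed
  then have "capacity m E Z \<le> 0" by (rule ennreal_le_epsilon)
  then show ?thesis by simp
qed

text \<open>
  A test function for an open \<open>U\<close> has \<open>L\<^sup>2\<close> norm at least \<open>m(U)\<^bsup>1/2\<^esup>\<close>, so capacity dominates the measure.
\<close>

lemma null_of_polar:
  assumes Z: "Z \<in> sets borel" and cap: "capacity m E Z = 0"
  shows "emeasure m Z = 0"
proof -
  have "emeasure m Z \<le> 0 + ennreal e" if "0 < e" for e
  proof -
    have "capacity m E Z < ennreal ((sqrt e)\<^sup>2)" using cap that by simp
    from small_of_capacity[OF this real_sqrt_ge_zero[OF less_imp_le[OF that]]]
    obtain U where U: "Z \<subseteq> U" "small (sqrt e) U" by blast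
    then obtain v where v: "open U" "v \<in> form_dom E" "AE x in m. x \<in> U \<longrightarrow> 1 \<le> v x"
      "E1.nrm v \<le> sqrt e" by (auto simp: small_def)
    have Um: "U \<in> sets m" using v(1) by (simp add: sets_eq)
    have "emeasure m Z \<le> emeasure m U" by (rule emeasure_mono[OF U(1) Um])
    also have "\<dots> = (\<integral>\<^sup>+x. indicator U x \<partial>m)" using Um by simp
    also have "\<dots> \<le> (\<integral>\<^sup>+x. ennreal ((v x)\<^sup>2) \<partial>m)"
    proof (rule nn_integral_mono_AE)
      show "AE x in m. indicator U x \<le> ennreal ((v x)\<^sup>2)"
        using v(3) by eventually_elim (auto simp: indicator_def one_le_power simp flip: ennreal_1 intro!: ennreal_leI)
    qed
    also have "\<dots> = ennreal (l2_inner m v v)"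
      using dom_L2[OF v(2)] nn_integral_eq_integral[of m "\<lambda>x. (v x)\<^sup>2"]
      by (simp add: L2_def l2_inner_def power2_eq_square)
    also have "\<dots> \<le> ennreal e"
      using l2_inner_le_shift[OF v(2)] E1.nrm_le_iff[OF _ v(2), of "sqrt e"] v(4) that
      by (intro ennreal_leI) auto
    finally show ?thesis by simp
  qed
  then have "emeasure m Z \<le> 0" by (rule ennreal_le_epsilon)
  then show ?thesis by simp
qed

text \<open>
  Small steps in the form norm keep the sets where \<open>u\<close> jumps by more than \<open>1 / 2 ^ n\<close> at step \<open>n\<close> so
  small that their union over \<open>n \<ge> k\<close> is small of order \<open>1 / 2 ^ k\<close>.  Outside this union, convergence is
  uniform.  The pointwise limit is chosen as the representative of the limit in the form domain:
  it is quasi-continuous by the uniform convergence, and it is the limit of the functions \<open>u n\<close>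
  almost everywhere for every Borel measure that charges no polar set.
\<close>

lemma quasi_uniform_limit:
  assumes u: "\<And>n. u n \<in> qc_dom m E"
    and step: "\<And>n. E1.nrm (\<lambda>x. u (Suc n) x - u n x) \<le> C / 4 ^ n"
  obtains v Z where "v \<in> qc_dom m E"
    and "(\<lambda>n. shift_val m 1 E (\<lambda>x. u n x - v x) (\<lambda>x. u n x - v x)) \<longlonglongrightarrow> 0"
    and "Z \<in> sets borel" "capacity m E Z = 0" "\<And>x. x \<notin> Z \<Longrightarrow> (\<lambda>n. u n x) \<longlonglongrightarrow> v x"
proof -
  have ud: "u n \<in> form_dom E" for n by (rule qc_dom_D[OF u])
  have C: "0 \<le> C" using step[of 0] E1.nrm_nonneg[OF E1.diff_mem[OF ud ud], of 1 0] by simp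
  \<comment> \<open>\<open>u n\<close> is continuous outside \<open>W k n\<close>; the double index keeps the union over \<open>n\<close> of order
    \<open>1 / 2 ^ k\<close>.\<close>
  have "\<exists>W. small ((1 / 2 ^ k) / 2 ^ n) W \<and> continuous_on (- W) (u n)" for k n :: nat
    by (rule qc_dom_obtain_small[OF u, of "(1 / 2 ^ k) / 2 ^ n" n]) auto
  then obtain W where W: "\<And>k n :: nat. small ((1 / 2 ^ k) / 2 ^ n) (W k n)"
    "\<And>k n. continuous_on (- W k n) (u n)" by metis
  have "\<exists>A. {x. 1 / 2 ^ n < \<bar>u (Suc n) x - u n x\<bar>} \<subseteq> A \<and> small ((2 * C + 1) / 2 ^ n) A" for n
  proof -
    let ?d = "\<lambda>x. u (Suc n) x - u n x"
    obtain A where A: "{x. 1 / 2 ^ n < \<bar>?d x\<bar>} \<subseteq> A"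
      "small (2 * E1.nrm ?d / (1 / 2 ^ n) + 1 / 2 ^ n) A"
      by (rule small_superlevel[OF qc_dom_diff[OF u u], of "1 / 2 ^ n" "1 / 2 ^ n" "Suc n" n]) auto
    \<comment> \<open>The step decays like \<open>1 / 4 ^ n\<close>, the threshold like \<open>1 / 2 ^ n\<close>; the quotient is summable.\<close>
    have "2 * E1.nrm ?d / (1 / 2 ^ n) + 1 / 2 ^ n \<le> 2 * (C / 4 ^ n) / (1 / 2 ^ n) + 1 / 2 ^ n"
      using step[of n] by (intro add_right_mono divide_right_mono mult_left_mono) auto
    also have "\<dots> = (2 * C + 1) / 2 ^ n"
    proof -
      have "(4::real) ^ n = 2 ^ n * 2 ^ n" by (simp flip: power_mult_distrib)
      then show ?thesis by (simp add: field_simps)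
    qed
    finally show ?thesis using A small_mono by blast
  qed
  then obtain A where A: "\<And>n. {x. 1 / 2 ^ n < \<bar>u (Suc n) x - u n x\<bar>} \<subseteq> A n"
    "\<And>n. small ((2 * C + 1) / 2 ^ n) (A n)" by metis
  define V where "V k = (\<Union>n. W k n \<union> A (n + k))" for k
  have V: "small ((4 * C + 4) / 2 ^ k) (V k)" for k
  proof -
    have "small (((2 * C + 2) / 2 ^ k) / 2 ^ n) (W k n \<union> A (n + k))" for n
    proof (rule small_mono[OF small_Un[OF W(1) A(2)]])
      show "1 / 2 ^ k / 2 ^ n + (2 * C + 1) / 2 ^ (n + k) \<le> ((2 * C + 2) / 2 ^ k) / 2 ^ n"
        by (simp add: power_add field_simps)
    qed
    then have "small (2 * ((2 * C + 2) / 2 ^ k)) (V k)" unfolding V_def by (rule small_UN)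
    then show ?thesis by (rule small_mono) (simp add: field_simps)
  qed
  have Vo: "open (V k)" for k using V by (simp add: small_def)
  have near: "\<bar>u j x - u i x\<bar> \<le> 2 / 2 ^ i - 2 / 2 ^ j" if x: "x \<notin> V k" and "k \<le> i" "i \<le> j" for x i j k
    using \<open>i \<le> j\<close>
  proof (induction j rule: dec_induct)
    case base
    then show ?case by simp
  next
    case (step j)
    have "x \<notin> A ((j - k) + k)" using x unfolding V_def by blast
    then have "\<bar>u (Suc j) x - u j x\<bar> \<le> 1 / 2 ^ j"
      using A(1)[of j] step \<open>k \<le> i\<close> by force
    moreover have "(1::real) / 2 ^ j = 2 / 2 ^ j - 2 / 2 ^ Suc j" by (simp add: field_simps)
    ultimately show ?case using step.IH by linarith
  qed
  define v where "v x = lim (\<lambda>n. u n x)" for x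
  have near': "\<bar>u j x - u i x\<bar> \<le> 2 / 2 ^ i" if "x \<notin> V k" "k \<le> i" "i \<le> j" for x i j k
  proof -
    have "0 \<le> (2::real) / 2 ^ j" by simp
    then show ?thesis using near[OF that] by linarith
  qed
  have geo: "(\<lambda>i. 2 / 2 ^ i :: real) \<longlonglongrightarrow> 0"
    using tendsto_mult_right_zero[OF LIMSEQ_power_zero[of "1/2::real"], of 2]
    by (simp add: power_divide)
  have lim: "(\<lambda>n. u n x) \<longlonglongrightarrow> v x" if x: "x \<notin> V k" for x k
  proof -
    have "Cauchy (\<lambda>n. u n x)"
    proof (rule CauchyI')
      fix e :: real assume "0 < e"
      then have "\<forall>\<^sub>F i in sequentially. 2 / 2 ^ i < e" by (rule order_tendstoD(2)[OF geo])
      then obtain N where N: "\<And>i. N \<le> i \<Longrightarrow> 2 / 2 ^ i < e"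
        unfolding eventually_sequentially by blast
      have "\<forall>i\<ge>max k N. \<forall>j>i. dist (u i x) (u j x) < e"
      proof (intro allI impI)
        fix i j assume ij: "max k N \<le> i" "i < j"
        have "dist (u i x) (u j x) = \<bar>u j x - u i x\<bar>" by (simp add: dist_real_def abs_minus_commute)
        also have "\<dots> \<le> 2 / 2 ^ i" using ij by (intro near'[OF x]) auto
        also have "\<dots> < e" using ij by (intro N) simp
        finally show "dist (u i x) (u j x) < e" .
      qed
      then show "\<exists>M. \<forall>i\<ge>M. \<forall>j>i. dist (u i x) (u j x) < e" by blast
    qed
    then show ?thesis
      unfolding v_def by (simp add: Cauchy_convergent_iff convergent_LIMSEQ_iff)
  qed
  have v_near: "\<bar>v x - u i x\<bar> \<le> 2 / 2 ^ i" if x: "x \<notin> V k" and "k \<le> i" for x i k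
  proof (rule LIMSEQ_le_const2)
    show "(\<lambda>j. \<bar>u j x - u i x\<bar>) \<longlonglongrightarrow> \<bar>v x - u i x\<bar>" by (intro tendsto_intros lim[OF x])
    show "\<exists>N. \<forall>j\<ge>N. \<bar>u j x - u i x\<bar> \<le> 2 / 2 ^ i" using near'[OF that] by blast
  qed
  have v_cont: "continuous_on (- V k) v" for k
  proof (rule uniform_limit_theorem)
    have "continuous_on (- V k) (u n)" for n
      by (rule continuous_on_subset[OF W(2)[of k n]]) (auto simp: V_def)
    then show "\<forall>\<^sub>F n in sequentially. continuous_on (- V k) (u n)" by simp
    show "uniform_limit (- V k) u v sequentially"
    proof (rule uniform_limitI)
      fix e :: real assume "0 < e"
      then have "\<forall>\<^sub>F i in sequentially. 2 / 2 ^ i < e" by (rule order_tendstoD(2)[OF geo])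
      then show "\<forall>\<^sub>F n in sequentially. \<forall>x\<in>- V k. dist (u n x) (v x) < e"
        using eventually_ge_at_top[of k]
      proof eventually_elim
        case (elim i)
        show ?case
        proof
          fix x assume "x \<in> - V k"
          then have "\<bar>v x - u i x\<bar> \<le> 2 / 2 ^ i" using v_near[of x k i] elim by simp
          then show "dist (u i x) (v x) < e"
            using elim(1) by (simp add: dist_real_def abs_minus_commute)
        qed
      qed
    qed
  qed simp
  have qc: "quasi_continuous m E v"
    unfolding quasi_continuous_iff_small
  proof (intro allI impI)
    fix s :: real assume "0 < s"
    have "(\<lambda>k. (4 * C + 4) / 2 ^ k) \<longlonglongrightarrow> 0"
      using tendsto_mult_right_zero[OF LIMSEQ_power_zero[of "1/2::real"], of "4 * C + 4"]
      by (simp add: power_divide)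
    from eventually_happens'[OF sequentially_bot order_tendstoD(2)[OF this \<open>0 < s\<close>]]
    obtain k where "(4 * C + 4) / 2 ^ k < s" by blast
    then show "\<exists>U. small s U \<and> continuous_on (- U) v"
      using small_mono[OF V[of k], of s] v_cont[of k] by auto
  qed
  define Z where "Z = (\<Inter>k. V k)"
  have Z: "Z \<in> sets borel" unfolding Z_def using Vo by auto
  have polar: "capacity m E Z = 0"
    by (rule polar_of_small[OF V]) (use C in \<open>auto simp: Z_def\<close>)
  have Zlim: "(\<lambda>n. u n x) \<longlonglongrightarrow> v x" if "x \<notin> Z" for x using that lim by (auto simp: Z_def)
  have "Z \<in> null_sets m" using null_of_polar[OF Z polar] Z by (auto simp: sets_eq)
  then have ae: "AE x in m. (\<lambda>n. u n x) \<longlonglongrightarrow> v x"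
    by (rule AE_I') (use Zlim in auto)
  obtain w where w: "w \<in> form_dom E"
    and wlim: "(\<lambda>n. shift_val m 1 E (\<lambda>x. u n x - w x) (\<lambda>x. u n x - w x)) \<longlonglongrightarrow> 0"
    using closed_form_complete[OF closed zero_less_one, unfolded E1.complete_def, rule_format, of u C]
      ud step by blast
  have vm: "v \<in> borel_measurable m"
    unfolding v_def by (rule borel_measurable_lim_metric) (rule L2_measurable[OF dom_L2[OF ud]])
  have wL: "w \<in> L2 m" by (rule dom_L2[OF w])
  \<comment> \<open>The pointwise limit \<open>v\<close> and the limit \<open>w\<close> in the form domain agree almost everywhere.\<close>
  have Fatou: "(\<lambda>x. v x - w x) \<in> L2 m" "l2_inner m (\<lambda>x. v x - w x) (\<lambda>x. v x - w x) \<le> e"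
    if "0 < e" for e
  proof -
    have d: "(\<lambda>x. u n x - w x) \<in> L2 m" for n by (intro L2.diff_mem dom_L2 ud w)
    have "AE x in m. (\<lambda>n. u n x - w x) \<longlonglongrightarrow> v x - w x"
      using ae by eventually_elim (intro tendsto_intros)
    moreover have "\<forall>\<^sub>F n in sequentially.
        l2_inner m (\<lambda>x. u n x - w x) (\<lambda>x. u n x - w x) \<le> e"
      using order_tendstoD(2)[OF wlim that]
      by eventually_elim (use l2_inner_le_shift[OF E1.diff_mem[OF ud w]] in \<open>auto intro: order_trans less_imp_le\<close>)
    moreover have "(\<lambda>x. v x - w x) \<in> borel_measurable m"
      by (intro borel_measurable_diff vm L2_measurable wL)
    ultimately show "(\<lambda>x. v x - w x) \<in> L2 m"
      "l2_inner m (\<lambda>x. v x - w x) (\<lambda>x. v x - w x) \<le> e"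
      using L2_Fatou[of "\<lambda>n x. u n x - w x" m "\<lambda>x. v x - w x" e] d by blast+
  qed
  have dL: "(\<lambda>x. v x - w x) \<in> L2 m" using Fatou(1)[OF zero_less_one] .
  have "l2_inner m (\<lambda>x. v x - w x) (\<lambda>x. v x - w x) \<le> 0"
    by (rule field_le_epsilon) (use Fatou(2) in simp)
  then have "l2_inner m (\<lambda>x. v x - w x) (\<lambda>x. v x - w x) = 0" using L2.nonneg[OF dL] by linarith
  then have vw: "AE x in m. w x = v x" using l2_inner_self_eq_0_iff[OF dL] by auto
  have "v \<in> L2 m" using L2.add_mem[OF dL wL] by simp
  then have vd: "v \<in> form_dom E" by (rule form_dom_saturated[OF positive_symmetric w _ vw])
  have "shift_val m 1 E (\<lambda>x. u n x - w x) (\<lambda>x. u n x - w x)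
      = shift_val m 1 E (\<lambda>x. u n x - v x) (\<lambda>x. u n x - v x)" for n
    by (rule shift_val_cong_AE[OF positive_symmetric]) (use vw in \<open>auto intro: E1.diff_mem ud w vd\<close>)
  then have "(\<lambda>n. shift_val m 1 E (\<lambda>x. u n x - v x) (\<lambda>x. u n x - v x)) \<longlonglongrightarrow> 0"
    using wlim by simp
  then show thesis
    using that[of v Z] vd qc Z polar Zlim by (auto simp: qc_dom_def)
qed

end


section \<open>The trace forms at positive parameters\<close>

text \<open>
  The parameter \<open>\<alpha>\<close> is fixed here, because \<open>\<alpha> \<down> 0\<close> enters only through the resolvents.
\<close>

locale trace_setting = borel_dirichlet_form m E
  for m :: "'a::topological_space measure" and E :: "'a l2_form" +
  fixes \<mu> :: "'a measure" and \<alpha> :: real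
  assumes sets_mu: "sets \<mu> = sets borel"
    and charge: "charges_no_polar_set m E \<mu>"
    and alpha: "0 < \<alpha>"
begin

sublocale Ea: psd_form "form_dom E" "shift_val m \<alpha> E"
  using alpha by (simp add: shift_psd[OF positive_symmetric])

lemma dom_J_qc: "u \<in> dom_J m \<mu> E \<Longrightarrow> u \<in> qc_dom m E"
  by (simp add: dom_J_def)

lemma dom_J_form_dom: "u \<in> dom_J m \<mu> E \<Longrightarrow> u \<in> form_dom E"
  by (simp add: dom_J_def qc_dom_def)

lemma dom_J_L2: "u \<in> dom_J m \<mu> E \<Longrightarrow> u \<in> L2 \<mu>"
  by (simp add: dom_J_def)

lemma dom_J_zero: "(\<lambda>x. 0) \<in> dom_J m \<mu> E"
  by (simp add: dom_J_def qc_dom_zero L2.zero_mem)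

lemma dom_J_add: "u \<in> dom_J m \<mu> E \<Longrightarrow> v \<in> dom_J m \<mu> E \<Longrightarrow> (\<lambda>x. u x + v x) \<in> dom_J m \<mu> E"
  by (simp add: dom_J_def qc_dom_add L2.add_mem)

lemma dom_J_scale: "u \<in> dom_J m \<mu> E \<Longrightarrow> (\<lambda>x. c * u x) \<in> dom_J m \<mu> E"
  by (simp add: dom_J_def qc_dom_scale L2.scale_mem)

lemma dom_J_diff: "u \<in> dom_J m \<mu> E \<Longrightarrow> v \<in> dom_J m \<mu> E \<Longrightarrow> (\<lambda>x. u x - v x) \<in> dom_J m \<mu> E"
  by (simp add: dom_J_def qc_dom_diff L2.diff_mem)

lemma ker_J_dom_J: "k \<in> ker_J m \<mu> E \<Longrightarrow> k \<in> dom_J m \<mu> E"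
  by (simp add: ker_J_def)

lemma ker_J_I: "u \<in> dom_J m \<mu> E \<Longrightarrow> v \<in> dom_J m \<mu> E \<Longrightarrow> AE x in \<mu>. u x = v x
    \<Longrightarrow> (\<lambda>x. u x - v x) \<in> ker_J m \<mu> E"
  by (simp add: ker_J_def dom_J_diff)

lemma dom_J_psd: "psd_form (dom_J m \<mu> E) (shift_val m \<alpha> E)"
  by (rule psd_form_subspace[OF Ea.psd_form_axioms])
    (auto intro: dom_J_form_dom dom_J_zero dom_J_add dom_J_scale)

text \<open>
  The quasi-continuous limit supplied by \<open>quasi_uniform_limit\<close> is also the limit \<open>\<mu>\<close>-almost everywhere,
  since \<open>\<mu>\<close> charges no polar set.  By Fatou's lemma it is then the limit in \<open>L\<^sup>2(\<mu>)\<close> as well.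
\<close>

lemma J_closed:
  assumes u: "\<And>n. u n \<in> dom_J m \<mu> E"
    and step: "\<And>n. Ea.nrm (\<lambda>x. u (Suc n) x - u n x) \<le> C / 4 ^ n"
    and step_mu: "\<And>n. l2_norm \<mu> (\<lambda>x. u (Suc n) x - u n x) \<le> C / 4 ^ n"
  obtains v where "v \<in> dom_J m \<mu> E"
    and "(\<lambda>n. shift_val m \<alpha> E (\<lambda>x. u n x - v x) (\<lambda>x. u n x - v x)) \<longlonglongrightarrow> 0"
    and "(\<lambda>n. l2_inner \<mu> (\<lambda>x. u n x - v x) (\<lambda>x. u n x - v x)) \<longlonglongrightarrow> 0"
proof -
  note uq = dom_J_qc[OF u] and ud = dom_J_form_dom[OF u] and uL = dom_J_L2[OF u]
  define K where "K = max 1 (1 / \<alpha>)"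
  have "E1.nrm (\<lambda>x. u (Suc n) x - u n x) \<le> (sqrt K * C) / 4 ^ n" for n
  proof -
    let ?d = "\<lambda>x. u (Suc n) x - u n x"
    have "E1.nrm ?d \<le> sqrt K * Ea.nrm ?d"
      unfolding K_def by (rule shift_nrm_le[OF positive_symmetric alpha zero_le_one E1.diff_mem[OF ud ud]])
    also have "\<dots> \<le> sqrt K * (C / 4 ^ n)"
      by (rule mult_left_mono[OF step]) (simp add: K_def)
    finally show ?thesis by simp
  qed
  from quasi_uniform_limit[of u, OF uq this] obtain v Z where v: "v \<in> qc_dom m E"
    and lim: "(\<lambda>n. shift_val m 1 E (\<lambda>x. u n x - v x) (\<lambda>x. u n x - v x)) \<longlonglongrightarrow> 0"
    and Z: "Z \<in> sets borel" "capacity m E Z = 0"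
    and Zlim: "\<And>x. x \<notin> Z \<Longrightarrow> (\<lambda>n. u n x) \<longlonglongrightarrow> v x"
    by blast
  note vd = qc_dom_D[OF v]
  have "Z \<in> null_sets \<mu>"
    using charge Z by (auto simp: charges_no_polar_set_def sets_mu)
  then have ae: "AE x in \<mu>. (\<lambda>n. u n x) \<longlonglongrightarrow> v x"
    by (rule AE_I') (use Zlim in auto)
  have "(borel_measurable \<mu> :: ('a \<Rightarrow> real) set) = borel_measurable m"
    by (rule measurable_cong_sets) (simp_all add: sets_mu sets_eq)
  then have vm: "v \<in> borel_measurable \<mu>"
    using L2_measurable[OF dom_L2[OF vd]] by simp
  have Fatou: "(\<lambda>x. v x - u i x) \<in> L2 \<mu>"
    "l2_inner \<mu> (\<lambda>x. v x - u i x) (\<lambda>x. v x - u i x) \<le> (2 * C / 4 ^ i)\<^sup>2" for i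
  proof -
    have d: "(\<lambda>x. u n x - u i x) \<in> L2 \<mu>" for n by (intro L2.diff_mem uL)
    have C: "0 \<le> C"
      using step_mu[of 0] L2.nrm_nonneg[OF L2.diff_mem[OF uL uL], of 1 0] by simp
    have "AE x in \<mu>. (\<lambda>n. u n x - u i x) \<longlonglongrightarrow> v x - u i x"
      using ae by eventually_elim (intro tendsto_intros)
    moreover have "\<forall>\<^sub>F n in sequentially.
        l2_inner \<mu> (\<lambda>x. u n x - u i x) (\<lambda>x. u n x - u i x) \<le> (2 * C / 4 ^ i)\<^sup>2"
      using eventually_ge_at_top[of i]
    proof eventually_elim
      case (elim n)
      show ?case
        using L2.nrm_geometric[of u, OF uL step_mu elim] L2.nrm_le_iff[OF _ d, of "2 * C / 4 ^ i" n] C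
        by simp
    qed
    moreover have "(\<lambda>x. v x - u i x) \<in> borel_measurable \<mu>"
      by (intro borel_measurable_diff vm L2_measurable uL)
    ultimately show "(\<lambda>x. v x - u i x) \<in> L2 \<mu>"
      "l2_inner \<mu> (\<lambda>x. v x - u i x) (\<lambda>x. v x - u i x) \<le> (2 * C / 4 ^ i)\<^sup>2"
      using L2_Fatou[of "\<lambda>n x. u n x - u i x" \<mu> "\<lambda>x. v x - u i x" "(2 * C / 4 ^ i)\<^sup>2"] d by blast+
  qed
  have vL: "v \<in> L2 \<mu>" using L2.add_mem[OF Fatou(1) uL, of 0 0] by simp
  show thesis
  proof (rule that[of v])
    show "v \<in> dom_J m \<mu> E" using v vL by (simp add: dom_J_def)
    show "(\<lambda>n. shift_val m \<alpha> E (\<lambda>x. u n x - v x) (\<lambda>x. u n x - v x)) \<longlonglongrightarrow> 0"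
      using alpha
      by (intro shift_val_tendsto_0[OF positive_symmetric zero_less_one _ _ lim] E1.diff_mem ud vd) simp
    show "(\<lambda>n. l2_inner \<mu> (\<lambda>x. u n x - v x) (\<lambda>x. u n x - v x)) \<longlonglongrightarrow> 0"
    proof (rule Lim_null_comparison)
      show "\<forall>\<^sub>F n in sequentially. norm (l2_inner \<mu> (\<lambda>x. u n x - v x) (\<lambda>x. u n x - v x))
          \<le> (2 * C * (1 / 4) ^ n)\<^sup>2"
      proof (intro always_eventually allI)
        fix n
        have "l2_inner \<mu> (\<lambda>x. u n x - v x) (\<lambda>x. u n x - v x)
            = l2_inner \<mu> (\<lambda>x. v x - u n x) (\<lambda>x. v x - u n x)"
          using L2.sym[OF uL vL, of n] by (simp add: L2.quad_diff uL vL)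
        then show "norm (l2_inner \<mu> (\<lambda>x. u n x - v x) (\<lambda>x. u n x - v x)) \<le> (2 * C * (1 / 4) ^ n)\<^sup>2"
          using Fatou(2)[of n] L2.nonneg[OF Fatou(1), of n] by (simp add: power_divide)
      qed
      have "(\<lambda>n. (2 * C * (1 / 4) ^ n)\<^sup>2) \<longlonglongrightarrow> (2 * C * 0)\<^sup>2"
        by (intro tendsto_intros LIMSEQ_power_zero) simp
      then show "(\<lambda>n. (2 * C * (1 / 4) ^ n)\<^sup>2) \<longlonglongrightarrow> 0" by simp
    qed
  qed
qed

lemma ker_J_psd: "psd_form (ker_J m \<mu> E) (shift_val m \<alpha> E)"
proof (rule psd_form_subspace[OF dom_J_psd])
  fix u v :: "'a \<Rightarrow> real" and c :: real
  assume u: "u \<in> ker_J m \<mu> E"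
  show "(\<lambda>x. c * u x) \<in> ker_J m \<mu> E" using u by (auto simp: ker_J_def dom_J_scale)
  assume v: "v \<in> ker_J m \<mu> E"
  have "AE x in \<mu>. u x = 0" "AE x in \<mu>. v x = 0" using u v by (auto simp: ker_J_def)
  then have "AE x in \<mu>. u x + v x = 0" by eventually_elim simp
  then show "(\<lambda>x. u x + v x) \<in> ker_J m \<mu> E" using u v by (simp add: ker_J_def dom_J_add)
qed (auto simp: ker_J_def dom_J_zero)

lemma ker_J_complete: "psd_form.complete (ker_J m \<mu> E) (shift_val m \<alpha> E)"
  unfolding psd_form.complete_def[OF ker_J_psd]
proof (intro allI impI)
  fix C :: real and u
  assume a: "\<forall>n. u n \<in> ker_J m \<mu> E \<and> Ea.nrm (\<lambda>x. u (Suc n) x - u n x) \<le> C / 4 ^ n"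
  have u: "u n \<in> dom_J m \<mu> E" and step: "Ea.nrm (\<lambda>x. u (Suc n) x - u n x) \<le> C / 4 ^ n"
    and u0: "AE x in \<mu>. u n x = 0" for n
    using spec[OF a, of n] by (simp_all add: ker_J_def)
  have C: "0 \<le> C"
    using step[of 0] Ea.nrm_nonneg[OF dom_J_form_dom[OF dom_J_diff[OF u u]], of 1 0] by simp
  have "l2_norm \<mu> (\<lambda>x. u (Suc n) x - u n x) \<le> C / 4 ^ n" for n
  proof -
    have "AE x in \<mu>. u (Suc n) x - u n x = 0"
      using u0[of n] u0[of "Suc n"] by eventually_elim simp
    then have "l2_norm \<mu> (\<lambda>x. u (Suc n) x - u n x) = 0"
      using l2_inner_self_eq_0_iff[OF dom_J_L2[OF dom_J_diff[OF u u]]] by (simp add: l2_norm_def)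
    then show ?thesis using C by simp
  qed
  from J_closed[of u, OF u step this] obtain v where v: "v \<in> dom_J m \<mu> E"
    and lim: "(\<lambda>n. shift_val m \<alpha> E (\<lambda>x. u n x - v x) (\<lambda>x. u n x - v x)) \<longlonglongrightarrow> 0"
    and lim_mu: "(\<lambda>n. l2_inner \<mu> (\<lambda>x. u n x - v x) (\<lambda>x. u n x - v x)) \<longlonglongrightarrow> 0" by blast
  note vL = dom_J_L2[OF v]
  have "l2_inner \<mu> (\<lambda>x. u n x - v x) (\<lambda>x. u n x - v x) = l2_inner \<mu> v v" for n
  proof -
    have "l2_inner \<mu> (u n) w = 0" if "w \<in> L2 \<mu>" for w
      using L2.null_left[OF dom_J_L2[OF u] that] l2_inner_self_eq_0_iff[OF dom_J_L2[OF u]] u0 by blast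
    then show ?thesis using L2.quad_diff[OF dom_J_L2[OF u] vL, of n] dom_J_L2[OF u] vL by simp
  qed
  then have "l2_inner \<mu> v v = 0" using lim_mu by (simp add: LIMSEQ_const_iff)
  then have "v \<in> ker_J m \<mu> E" using v l2_inner_self_eq_0_iff[OF vL] by (simp add: ker_J_def)
  then show "\<exists>v\<in>ker_J m \<mu> E.
      (\<lambda>n. shift_val m \<alpha> E (\<lambda>x. u n x - v x) (\<lambda>x. u n x - v x)) \<longlonglongrightarrow> 0"
    using lim by blast
qed

text \<open>
  \<open>w\<close> is the quasi-continuous extension of \<open>v\<close> of least energy \<open>\<E>\<^sub>\<alpha>\<close>.  The elements chosen by
  \<open>proj_P\<close> need only be \<open>m\<close>-almost everywhere equal to it, while \<open>w\<close> is also known to represent \<open>v\<close> for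
  \<open>\<mu>\<close>; the relation is linear, so it transports the structure of \<open>\<E>\<^sub>\<alpha>\<close> to the trace form.
\<close>

definition energy_lift :: "('a \<Rightarrow> real) \<Rightarrow> ('a \<Rightarrow> real) \<Rightarrow> bool" where
  "energy_lift v w \<longleftrightarrow> v \<in> L2 \<mu> \<and> w \<in> dom_J m \<mu> E \<and> w \<in> ker_J_perp m \<mu> E \<alpha> \<and> (AE x in \<mu>. w x = v x)"

lemma perp_D: "w \<in> ker_J_perp m \<mu> E \<alpha> \<Longrightarrow> k \<in> ker_J m \<mu> E \<Longrightarrow> shift_val m \<alpha> E w k = 0"
  by (simp add: ker_J_perp_def)

lemma perp_qc: "w \<in> ker_J_perp m \<mu> E \<alpha> \<Longrightarrow> w \<in> qc_dom m E"
  by (simp add: ker_J_perp_def)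

lemma perp_diff:
  assumes "u \<in> ker_J_perp m \<mu> E \<alpha>" "v \<in> ker_J_perp m \<mu> E \<alpha>"
  shows "(\<lambda>x. u x - v x) \<in> ker_J_perp m \<mu> E \<alpha>"
proof -
  have d: "u \<in> qc_dom m E" "v \<in> qc_dom m E" using assms by (auto intro: perp_qc)
  have "shift_val m \<alpha> E (\<lambda>x. u x - v x) k = 0" if "k \<in> ker_J m \<mu> E" for k
    using Ea.diff_left[OF qc_dom_D[OF d(1)] qc_dom_D[OF d(2)] dom_J_form_dom[OF ker_J_dom_J[OF that]]]
      perp_D[OF assms(1) that] perp_D[OF assms(2) that] by simp
  then show ?thesis by (simp add: ker_J_perp_def qc_dom_diff d)
qed

text \<open>
  The orthogonal projection of \<open>u\<close> to \<open>ker J\<close>, which is complete because \<open>J\<close> is closed.  Subtracting it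
  realises the projection to the complement of \<open>ker J\<close> inside \<open>dom J\<close>.
\<close>

lemma ker_J_projection:
  assumes u: "u \<in> dom_J m \<mu> E"
  obtains k where "k \<in> ker_J m \<mu> E" "(\<lambda>x. u x - k x) \<in> ker_J_perp m \<mu> E \<alpha>"
proof -
  interpret K: psd_form "ker_J m \<mu> E" "shift_val m \<alpha> E" by (rule ker_J_psd)
  note D = dom_J_form_dom[OF ker_J_dom_J] and ud = dom_J_form_dom[OF u]
  have "\<exists>k\<in>ker_J m \<mu> E. \<forall>z\<in>ker_J m \<mu> E. shift_val m \<alpha> E k z = shift_val m \<alpha> E u z"
    by (rule K.riesz[OF ker_J_complete, where K = "shift_val m \<alpha> E u u"])
      (auto intro: Ea.add_right Ea.scale_right Ea.cauchy_schwarz_square ud D)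
  then obtain k where k: "k \<in> ker_J m \<mu> E"
    and eq: "\<And>z. z \<in> ker_J m \<mu> E \<Longrightarrow> shift_val m \<alpha> E k z = shift_val m \<alpha> E u z" by blast
  have "(\<lambda>x. u x - k x) \<in> ker_J_perp m \<mu> E \<alpha>"
    using eq by (simp add: ker_J_perp_def qc_dom_diff dom_J_qc u ker_J_dom_J k Ea.diff_left ud D)
  with k show thesis by (rule that)
qed

lemma energy_lift_exists:
  assumes "v \<in> ran_J m \<mu> E"
  obtains w where "energy_lift v w"
proof -
  obtain u where u: "u \<in> dom_J m \<mu> E" and uv: "AE x in \<mu>. u x = v x" and v: "v \<in> L2 \<mu>"
    using assms by (auto simp: ran_J_def)
  obtain k where k: "k \<in> ker_J m \<mu> E" "(\<lambda>x. u x - k x) \<in> ker_J_perp m \<mu> E \<alpha>"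
    by (rule ker_J_projection[OF u])
  have "AE x in \<mu>. k x = 0" using k by (simp add: ker_J_def)
  then have "AE x in \<mu>. u x - k x = v x" using uv by eventually_elim simp
  then have "energy_lift v (\<lambda>x. u x - k x)"
    using k v u by (simp add: energy_lift_def dom_J_diff ker_J_dom_J)
  then show thesis by (rule that)
qed

lemma energy_lift_ran_J: "energy_lift v w \<Longrightarrow> v \<in> ran_J m \<mu> E"
  by (auto simp: energy_lift_def ran_J_def)

lemma energy_lift_form_dom: "energy_lift v w \<Longrightarrow> w \<in> form_dom E"
  by (simp add: energy_lift_def dom_J_form_dom)

lemma energy_lift_zero: "energy_lift (\<lambda>x. 0) (\<lambda>x. 0)"
  by (auto simp: energy_lift_def L2.zero_mem dom_J_zero ker_J_perp_def qc_dom_zero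
      Ea.zero_left dom_J_form_dom ker_J_dom_J)

lemma energy_lift_add:
  assumes "energy_lift v w" "energy_lift v' w'"
  shows "energy_lift (\<lambda>x. v x + v' x) (\<lambda>x. w x + w' x)"
proof -
  have "AE x in \<mu>. w x = v x" "AE x in \<mu>. w' x = v' x" using assms by (auto simp: energy_lift_def)
  then have "AE x in \<mu>. w x + w' x = v x + v' x" by eventually_elim simp
  then show ?thesis
    using assms unfolding energy_lift_def
    by (auto simp: L2.add_mem dom_J_add ker_J_perp_def qc_dom_add Ea.add_left dom_J_form_dom ker_J_dom_J)
qed

lemma energy_lift_scale:
  assumes "energy_lift v w"
  shows "energy_lift (\<lambda>x. c * v x) (\<lambda>x. c * w x)"
proof -
  have "AE x in \<mu>. w x = v x" using assms by (auto simp: energy_lift_def)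
  then have "AE x in \<mu>. c * w x = c * v x" by eventually_elim simp
  then show ?thesis
    using assms unfolding energy_lift_def
    by (auto simp: L2.scale_mem dom_J_scale ker_J_perp_def qc_dom_scale Ea.scale_left dom_J_form_dom ker_J_dom_J)
qed

text \<open>
  A preimage of \<open>v\<close> differs from \<open>w\<close> by an element of \<open>ker J\<close>, so \<open>w\<close> satisfies the
  condition by which \<open>proj_P\<close> is chosen.  That condition determines an element up to energy zero.
\<close>

lemma proj_P_energy_lift:
  assumes "energy_lift v w"
  defines "p \<equiv> proj_P m \<mu> E \<alpha> (J_preimage m \<mu> E v)"
  shows "p \<in> form_dom E" "shift_val m \<alpha> E (\<lambda>x. p x - w x) (\<lambda>x. p x - w x) = 0"
proof -
  have w: "w \<in> dom_J m \<mu> E" "w \<in> ker_J_perp m \<mu> E \<alpha>" and wv: "AE x in \<mu>. w x = v x"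
    using assms by (auto simp: energy_lift_def)
  define u where "u = J_preimage m \<mu> E v"
  have u: "u \<in> dom_J m \<mu> E" "AE x in \<mu>. u x = v x"
    unfolding u_def J_preimage_def
    using someI[of "\<lambda>u. u \<in> dom_J m \<mu> E \<and> (AE x in \<mu>. u x = v x)" w] w wv by blast+
  have "AE x in \<mu>. u x = w x" using u(2) wv by eventually_elim simp
  then have k: "(\<lambda>x. u x - w x) \<in> ker_J m \<mu> E" by (rule ker_J_I[OF u(1) w(1)])
  note ud = dom_J_form_dom[OF u(1)] and wd = dom_J_form_dom[OF w(1)]
  have orth: "shift_val m \<alpha> E (\<lambda>x. u x - w x) z = 0" if "z \<in> ker_J_perp m \<mu> E \<alpha>" for z
    using perp_D[OF that k] Ea.sym[OF E1.diff_mem[OF ud wd] qc_dom_D[OF perp_qc[OF that]]] by simp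
  have p: "p \<in> ker_J_perp m \<mu> E \<alpha>"
    and porth: "\<forall>z\<in>ker_J_perp m \<mu> E \<alpha>. shift_val m \<alpha> E (\<lambda>x. u x - p x) z = 0"
    unfolding p_def proj_P_def u_def[symmetric]
    using someI[of "\<lambda>w. w \<in> ker_J_perp m \<mu> E \<alpha> \<and>
        (\<forall>z\<in>ker_J_perp m \<mu> E \<alpha>. shift_val m \<alpha> E (\<lambda>x. u x - w x) z = 0)" w] w orth by blast+
  show pd: "p \<in> form_dom E" by (rule qc_dom_D[OF perp_qc[OF p]])
  let ?d = "\<lambda>x. p x - w x"
  have d: "?d \<in> ker_J_perp m \<mu> E \<alpha>" by (rule perp_diff[OF p w(2)])
  have dd: "?d \<in> form_dom E" by (rule qc_dom_D[OF perp_qc[OF d]])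
  show "shift_val m \<alpha> E ?d ?d = 0"
    using orth[OF d] porth[rule_format, OF d] Ea.diff_left[OF ud wd dd] Ea.diff_left[OF ud pd dd]
      Ea.diff_left[OF pd wd dd] by simp
qed

lemma check_form_dom: "form_dom (check_form m \<mu> E \<alpha>) = ran_J m \<mu> E"
  by (simp add: check_form_def)

lemma check_form_val:
  assumes v: "energy_lift v w" and v': "energy_lift v' w'"
  shows "form_val (check_form m \<mu> E \<alpha>) v v' = shift_val m \<alpha> E w w'"
proof -
  define p where "p = proj_P m \<mu> E \<alpha> (J_preimage m \<mu> E v)"
  define p' where "p' = proj_P m \<mu> E \<alpha> (J_preimage m \<mu> E v')"
  note p = proj_P_energy_lift[OF v, folded p_def] and p' = proj_P_energy_lift[OF v', folded p'_def]
  note w = energy_lift_form_dom[OF v] and w' = energy_lift_form_dom[OF v']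
  have "shift_val m \<alpha> E p p' = shift_val m \<alpha> E w p'"
    by (rule Ea.cong_left[OF p(1) w p'(1) p(2)])
  also have "\<dots> = shift_val m \<alpha> E p' w" by (rule Ea.sym[OF w p'(1)])
  also have "\<dots> = shift_val m \<alpha> E w' w" by (rule Ea.cong_left[OF p'(1) w' w p'(2)])
  also have "\<dots> = shift_val m \<alpha> E w w'" by (rule Ea.sym[OF w' w])
  finally show ?thesis by (simp add: check_form_def p_def p'_def)
qed

lemma check_form_psd:
  "psd_form (form_dom (check_form m \<mu> E \<alpha>)) (form_val (check_form m \<mu> E \<alpha>))"
  unfolding check_form_dom
proof
  note lift = energy_lift_exists
  fix u v w :: "'a \<Rightarrow> real" and c :: real
  show "(\<lambda>x. 0) \<in> ran_J m \<mu> E" by (rule energy_lift_ran_J[OF energy_lift_zero])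
  assume u: "u \<in> ran_J m \<mu> E"
  obtain u' where u': "energy_lift u u'" by (rule lift[OF u])
  note ud = energy_lift_form_dom[OF u']
  show "(\<lambda>x. c * u x) \<in> ran_J m \<mu> E" by (rule energy_lift_ran_J[OF energy_lift_scale[OF u']])
  show "0 \<le> form_val (check_form m \<mu> E \<alpha>) u u"
    unfolding check_form_val[OF u' u'] by (rule Ea.nonneg[OF ud])
  {
    assume w: "w \<in> ran_J m \<mu> E"
    obtain w' where w': "energy_lift w w'" by (rule lift[OF w])
    show "form_val (check_form m \<mu> E \<alpha>) (\<lambda>x. c * u x) w = c * form_val (check_form m \<mu> E \<alpha>) u w"
      using Ea.scale_left[OF ud energy_lift_form_dom[OF w']]
      by (simp add: check_form_val[OF energy_lift_scale[OF u'] w'] check_form_val[OF u' w'])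
  }
  assume v: "v \<in> ran_J m \<mu> E"
  obtain v' where v': "energy_lift v v'" by (rule lift[OF v])
  note vd = energy_lift_form_dom[OF v']
  show "(\<lambda>x. u x + v x) \<in> ran_J m \<mu> E" by (rule energy_lift_ran_J[OF energy_lift_add[OF u' v']])
  show "form_val (check_form m \<mu> E \<alpha>) u v = form_val (check_form m \<mu> E \<alpha>) v u"
    unfolding check_form_val[OF u' v'] check_form_val[OF v' u'] by (rule Ea.sym[OF ud vd])
  assume w: "w \<in> ran_J m \<mu> E"
  obtain w' where w': "energy_lift w w'" by (rule lift[OF w])
  show "form_val (check_form m \<mu> E \<alpha>) (\<lambda>x. u x + v x) w
      = form_val (check_form m \<mu> E \<alpha>) u w + form_val (check_form m \<mu> E \<alpha>) v w"
    unfolding check_form_val[OF energy_lift_add[OF u' v'] w'] check_form_val[OF u' w']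
      check_form_val[OF v' w'] by (rule Ea.add_left[OF ud vd energy_lift_form_dom[OF w']])
qed

text \<open>
  With \<open>w\<close> the minimiser for \<open>v\<close>, the cut-off of \<open>w\<close> is quasi-continuous and represents the cut-off of
  \<open>v\<close> for \<open>\<mu>\<close>.  Its energy is at most that of \<open>w\<close> and at least that of the minimiser \<open>z\<close>.
\<close>

lemma check_form_markovian:
  assumes "v \<in> form_dom (check_form m \<mu> E \<alpha>)"
  shows "unit_contraction v \<in> form_dom (check_form m \<mu> E \<alpha>)"
    and "form_val (check_form m \<mu> E \<alpha>) (unit_contraction v) (unit_contraction v)
      \<le> form_val (check_form m \<mu> E \<alpha>) v v"
proof -
  obtain w where lift: "energy_lift v w"
    using assms energy_lift_exists unfolding check_form_dom by blast
  then have w: "w \<in> dom_J m \<mu> E" and wv: "AE x in \<mu>. w x = v x" and v: "v \<in> L2 \<mu>"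
    by (auto simp: energy_lift_def)
  note wd = dom_J_form_dom[OF w]
  have Tw: "unit_contraction w \<in> dom_J m \<mu> E"
    using w by (simp add: dom_J_def qc_dom_contraction unit_contraction_L2)
  have Twv: "AE x in \<mu>. unit_contraction w x = unit_contraction v x"
    using wv by eventually_elim (simp add: unit_contraction_def)
  show "unit_contraction v \<in> form_dom (check_form m \<mu> E \<alpha>)"
    unfolding check_form_dom ran_J_def using Tw Twv unit_contraction_L2(1)[OF v] by blast
  then obtain z where z: "energy_lift (unit_contraction v) z"
    using energy_lift_exists unfolding check_form_dom by blast
  then have zJ: "z \<in> dom_J m \<mu> E" "z \<in> ker_J_perp m \<mu> E \<alpha>" and "AE x in \<mu>. z x = unit_contraction v x"
    by (auto simp: energy_lift_def)
  then have "AE x in \<mu>. unit_contraction w x = z x" using Twv by (auto elim: AE_mp)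
  from perp_D[OF zJ(2) ker_J_I[OF Tw zJ(1) this]]
  have "shift_val m \<alpha> E z (\<lambda>x. unit_contraction w x - z x) = 0" .
  then have "shift_val m \<alpha> E z (unit_contraction w) = shift_val m \<alpha> E z z"
    using Ea.diff_right[OF dom_J_form_dom[OF Tw] dom_J_form_dom[OF zJ(1)] dom_J_form_dom[OF zJ(1)]]
    by simp
  then have "shift_val m \<alpha> E z z \<le> shift_val m \<alpha> E (unit_contraction w) (unit_contraction w)"
    using Ea.dual_bound[OF dom_J_form_dom[OF zJ(1)] dom_J_form_dom[OF Tw]] by simp
  also have "\<dots> \<le> shift_val m \<alpha> E w w"
    using alpha by (intro contraction_shift_le[OF wd]) simp
  finally show "form_val (check_form m \<mu> E \<alpha>) (unit_contraction v) (unit_contraction v)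
      \<le> form_val (check_form m \<mu> E \<alpha>) v v"
    by (simp add: check_form_val[OF z z] check_form_val[OF lift lift])
qed

text \<open>
  Closedness of \<open>J\<close> means that \<open>dom J\<close> is complete for \<open>\<E>\<^sub>\<alpha>\<close> plus the \<open>L\<^sup>2(\<mu>)\<close> inner product, so
  \<open>\<langle>f, _\<rangle>\<close> is represented by some \<open>w\<close>.  Testing with \<open>ker J\<close>, on which both \<open>L\<^sup>2(\<mu>)\<close> products vanish,
  shows that \<open>w\<close> is a minimiser for its own values.
\<close>

lemma check_form_resolvent_exists:
  assumes f: "f \<in> L2 \<mu>"
  shows "\<exists>u. (u, \<lambda>x. f x - u x) \<in> form_operator \<mu> (check_form m \<mu> E \<alpha>)"
proof -
  define Q where "Q u v = shift_val m \<alpha> E u v + 1 * l2_inner \<mu> u v" for u v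
  have "psd_form (dom_J m \<mu> E) (\<lambda>u v. shift_val m \<alpha> E u v + 1 * l2_inner \<mu> u v)"
    by (rule psd_form_add_scaled[OF dom_J_psd L2.psd_form_axioms]) (auto intro: dom_J_L2)
  then interpret Q: psd_form "dom_J m \<mu> E" Q unfolding Q_def[abs_def] .
  note D = dom_J_form_dom
  have le: "shift_val m \<alpha> E u u \<le> Q u u" "l2_inner \<mu> u u \<le> Q u u" if "u \<in> dom_J m \<mu> E" for u
    using Ea.nonneg[OF D[OF that]] L2.nonneg[OF dom_J_L2[OF that]] by (simp_all add: Q_def)
  have complete: "Q.complete"
    unfolding Q.complete_def
  proof (intro allI impI)
    fix C :: real and u
    assume a: "\<forall>n. u n \<in> dom_J m \<mu> E \<and> Q.nrm (\<lambda>x. u (Suc n) x - u n x) \<le> C / 4 ^ n"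
    have u: "u n \<in> dom_J m \<mu> E" and step: "Q.nrm (\<lambda>x. u (Suc n) x - u n x) \<le> C / 4 ^ n" for n
      using spec[OF a, of n] by simp_all
    have "Ea.nrm (\<lambda>x. u (Suc n) x - u n x) \<le> C / 4 ^ n" "l2_norm \<mu> (\<lambda>x. u (Suc n) x - u n x) \<le> C / 4 ^ n" for n
      using le[OF dom_J_diff[OF u u], of "Suc n" n] step[of n] unfolding Ea.nrm_def l2_norm_def Q.nrm_def
      by (meson order_trans real_sqrt_le_mono)+
    from J_closed[of u, OF u this] obtain v where v: "v \<in> dom_J m \<mu> E"
      and "(\<lambda>n. shift_val m \<alpha> E (\<lambda>x. u n x - v x) (\<lambda>x. u n x - v x)) \<longlonglongrightarrow> 0"
      and "(\<lambda>n. l2_inner \<mu> (\<lambda>x. u n x - v x) (\<lambda>x. u n x - v x)) \<longlonglongrightarrow> 0" by blast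
    from tendsto_add[OF this(2,3)] v
    show "\<exists>v\<in>dom_J m \<mu> E. (\<lambda>n. Q (\<lambda>x. u n x - v x) (\<lambda>x. u n x - v x)) \<longlonglongrightarrow> 0"
      by (auto simp: Q_def)
  qed
  have "\<exists>w\<in>dom_J m \<mu> E. \<forall>v\<in>dom_J m \<mu> E. Q w v = l2_inner \<mu> f v"
  proof (rule Q.riesz[OF complete, where K = "l2_inner \<mu> f f"])
    fix u assume u: "u \<in> dom_J m \<mu> E"
    have "(l2_inner \<mu> f u)\<^sup>2 \<le> l2_inner \<mu> f f * l2_inner \<mu> u u"
      by (rule L2.cauchy_schwarz_square[OF f dom_J_L2[OF u]])
    also have "\<dots> \<le> l2_inner \<mu> f f * Q u u"
      by (rule mult_left_mono[OF le(2)[OF u] L2.nonneg[OF f]])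
    finally show "(l2_inner \<mu> f u)\<^sup>2 \<le> l2_inner \<mu> f f * Q u u" .
  qed (auto intro: L2.add_right L2.scale_right f dom_J_L2)
  then obtain w where w: "w \<in> dom_J m \<mu> E"
    and eq: "\<And>v. v \<in> dom_J m \<mu> E \<Longrightarrow> shift_val m \<alpha> E w v + l2_inner \<mu> w v = l2_inner \<mu> f v"
    by (auto simp: Q_def)
  note wL = dom_J_L2[OF w]
  have "shift_val m \<alpha> E w k = 0" if k: "k \<in> ker_J m \<mu> E" for k
  proof -
    note kL = dom_J_L2[OF ker_J_dom_J[OF k]]
    have "l2_inner \<mu> k k = 0" using l2_inner_self_eq_0_iff[OF kL] k by (simp add: ker_J_def)
    then have "l2_inner \<mu> w k = 0" "l2_inner \<mu> f k = 0"
      using L2.null_left[OF kL wL] L2.null_left[OF kL f] L2.sym[OF kL wL] L2.sym[OF kL f] by simp_all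
    then show ?thesis using eq[OF ker_J_dom_J[OF k]] by simp
  qed
  then have lift: "energy_lift w w"
    using w wL by (simp add: energy_lift_def ker_J_perp_def dom_J_qc)
  have fw: "(\<lambda>x. f x - w x) \<in> L2 \<mu>" by (rule L2.diff_mem[OF f wL])
  have "form_val (check_form m \<mu> E \<alpha>) w v = l2_inner \<mu> (\<lambda>x. f x - w x) v"
    if v: "v \<in> ran_J m \<mu> E" for v
  proof -
    obtain v' where v': "energy_lift v v'" by (rule energy_lift_exists[OF v])
    then have v'J: "v' \<in> dom_J m \<mu> E" and vL: "v \<in> L2 \<mu>" and ae: "AE x in \<mu>. v' x = v x"
      by (auto simp: energy_lift_def)
    have "form_val (check_form m \<mu> E \<alpha>) w v = shift_val m \<alpha> E w v'"
      by (rule check_form_val[OF lift v'])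
    also have "\<dots> = l2_inner \<mu> (\<lambda>x. f x - w x) v'"
      using eq[OF v'J] by (simp add: L2.diff_left[OF f wL dom_J_L2[OF v'J]])
    also have "\<dots> = l2_inner \<mu> (\<lambda>x. f x - w x) v"
      by (rule l2_inner_cong_AE[OF fw fw dom_J_L2[OF v'J] vL _ ae]) simp
    finally show ?thesis .
  qed
  then have "(w, \<lambda>x. f x - w x) \<in> form_operator \<mu> (check_form m \<mu> E \<alpha>)"
    using fw energy_lift_ran_J[OF lift] by (simp add: form_operator_def check_form_dom)
  then show ?thesis by blast
qed

end

theorem theorem5p2:
  fixes m \<mu> :: "'a::{metric_space, second_countable_topology} measure"
    and \<E> \<F> :: "'a l2_form"
  assumes "locally compact (UNIV :: 'a set)"
    and "radon_measure m" and "full_support m"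
    and "radon_measure \<mu>"
    and "dirichlet_form m \<E>" and "regular_form m \<E>"
    and "charges_no_polar_set m \<E> \<mu>"
    and "is_trace_form m \<mu> \<E> \<F>"
  shows "dirichlet_form \<mu> \<F>"
proof -
  have closed: "closed_form \<mu> \<F>" and dense: "densely_defined \<mu> \<F>"
    and conv: "\<And>f. f \<in> L2 \<mu> \<Longrightarrow>
      ((\<lambda>\<alpha>. l2_norm \<mu> (\<lambda>x. resolvent1 (form_operator \<mu> (check_form m \<mu> \<E> \<alpha>)) f x
        - resolvent1 (form_operator \<mu> \<F>) f x)) \<longlongrightarrow> 0) (at_right 0)"
    using \<open>is_trace_form m \<mu> \<E> \<F>\<close> by (auto simp: is_trace_form_def)
  have T: "trace_setting m \<E> \<mu> \<alpha>" if "0 < \<alpha>" for \<alpha>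
    by unfold_locales (use assms that in \<open>auto simp: radon_measure_def\<close>)
  have pos: "\<forall>\<^sub>F \<alpha> in at_right (0::real). 0 < \<alpha>" by (rule eventually_at_right_less)
  have psd: "\<forall>\<^sub>F \<alpha> in at_right (0::real).
      psd_form (form_dom (check_form m \<mu> \<E> \<alpha>)) (form_val (check_form m \<mu> \<E> \<alpha>)) \<and>
      form_dom (check_form m \<mu> \<E> \<alpha>) \<subseteq> L2 \<mu>"
    using pos
  proof eventually_elim
    case (elim \<alpha>)
    have "form_dom (check_form m \<mu> \<E> \<alpha>) \<subseteq> L2 \<mu>" by (auto simp: check_form_def ran_J_def)
    then show ?case using trace_setting.check_form_psd[OF T[OF elim]] by blast
  qed
  have ex: "\<forall>\<^sub>F \<alpha> in at_right (0::real). \<forall>f\<in>L2 \<mu>.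
      \<exists>u. (u, \<lambda>x. f x - u x) \<in> form_operator \<mu> (check_form m \<mu> \<E> \<alpha>)"
    using pos by eventually_elim (blast intro: trace_setting.check_form_resolvent_exists[OF T])
  have markov: "\<forall>\<^sub>F \<alpha> in at_right (0::real). \<forall>u\<in>form_dom (check_form m \<mu> \<E> \<alpha>).
      unit_contraction u \<in> form_dom (check_form m \<mu> \<E> \<alpha>) \<and>
      form_val (check_form m \<mu> \<E> \<alpha>) (unit_contraction u) (unit_contraction u)
        \<le> form_val (check_form m \<mu> \<E> \<alpha>) u u"
    using pos by eventually_elim (blast intro: trace_setting.check_form_markovian[OF T])
  show ?thesis
    unfolding dirichlet_form_def
    using closed dense markovian_of_strong_resolvent_limit[OF closed _ psd ex markov conv] by simp
qed

end
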